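(* There is a one-to-one correspondence between collections of $n$ pairs of random arcs and $n$-generator Fuchsian groups. A randomly chosen $\langle f\rangle\subset\mathcal F$ corresponds uniquely to midpoints $m_{\alpha_1},m_{\alpha_2}$ uniformly distributed on the unit circle $\mathbb S$ and an arclength $\ell_\alpha$ uniformly distributed in $[0,\pi]$.
   Context: $\mathbb S$ is the unit circle in $\mathbb C$. $\mathcal F$ is the group of matrices $A=\pm\begin{pmatrix} a & c\\ \bar c & \bar a\end{pmatrix}\in PSL(2,\mathbb C)$ with $|a|^2-|c|^2=1$, identified with the group of Möbius transformations $f(z)=\frac{az+c}{\bar c z+\bar a}$ preserving $\mathbb S$. A random element $f\in\mathcal F$ is obtained by choosing $a/|a|$ and $c/|c|$ uniformly on $\mathbb S$ with respect to arclength, and $|a|\ge1$ so that $2\arcsin(1/|a|)$ is uniformly distributed in $[0,\pi]$; a randomly chosen $\langle f\rangle$ is the cyclic group generated by such an $f$. An $n$-generator Fuchsian group here means a group $\langle f_1,\dots,f_n\rangle$ generated by $n$ elements of $\mathcal F$ (discreteness is not presupposed). A pair of random arcs consists of two arcs $\alpha_1,\alpha_2$ of $\mathbb S$ with midpoints $m_{\alpha_1},m_{\alpha_2}$ chosen uniformly on $\mathbb S$ and with common arclength $\ell_\alpha$ chosen uniformly in $[0,\pi]$. The correspondence is through isometric circles: the isometric circles of $f$ are $\{|z+\bar a/\bar c|=1/|c|\}$ and $\{|z-a/\bar c|=1/|c|\}$, and the finite disks they bound meet $\mathbb S$ in two arcs of equal length $\ell$ with $\sin(\ell/2)=1/|a|$.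 Conversely, the data $m_{\alpha_1},m_{\alpha_2},\ell_\alpha$ determine a matrix in $\mathcal F$ having these arcs; interchanging $m_{\alpha_1}$ and $m_{\alpha_2}$ sends $a$ to $-\bar a$, so the data determine the cyclic group $\langle f\rangle$ and not necessarily $f$ itself.
   Formalization: Since ⟨f,g⟩=⟨f,fg⟩, and ⟨f⟩=⟨f²⟩ for f of order 5, groups are taken with their generators marked up to inversion, or by their cyclic groups when all are infinite; arclengths 0 and π and rotations (c=0) are excluded, and the correspondence of random ⟨f⟩ with arcs holds almost surely. *)

theory Defs
  imports "HOL-Probability.Probability" "HOL-Algebra.Generated_Groups"
begin

definition SL2C :: "(complex^2^2) monoid" where
  "SL2C = \<lparr>carrier = {A. det A = 1}, mult = (**), one = mat 1\<rparr>"

text \<open>An element of \<open>PSL2C\<close> is a coset \<open>{A, - A}\<close>.\<close>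

definition PSL2C :: "(complex^2^2) set monoid" where
  "PSL2C = SL2C Mod {mat 1, - mat 1}"

definition fuchs_elem :: "complex \<Rightarrow> complex \<Rightarrow> (complex^2^2) set" where
  "fuchs_elem a c =
     {mat 1, - mat 1} #>\<^bsub>SL2C\<^esub> vector [vector [a, c], vector [cnj c, cnj a]]"

definition coeffs :: "(complex \<times> complex) set" where
  "coeffs = {(a, c). (cmod a)\<^sup>2 - (cmod c)\<^sup>2 = 1}"

definition fuchs_group :: "(complex^2^2) set set" where
  "fuchs_group = {fuchs_elem a c | a c. (a, c) \<in> coeffs}"

abbreviation cyclic :: "(complex^2^2) set \<Rightarrow> (complex^2^2) set set" where
  "cyclic f \<equiv> generate PSL2C {f}"

text \<open>For \<open>A\<close> with rows \<open>(a, c)\<close> and \<open>(cnj c, cnj a)\<close> the two isometric disks are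
  \<open>cball (- cnj a / cnj c) (1 / cmod c)\<close> and \<open>cball (a / cnj c) (1 / cmod c)\<close>. Both are
  unchanged if \<open>A\<close> is replaced by \<open>- A\<close>, so each union below is over two equal disks.
  If \<open>c = 0\<close>, there is no isometric circle: then division by zero turns each disk into
  \<open>{0}\<close>, and both arcs are empty.\<close>

definition isom_arc1 :: "(complex^2^2) set \<Rightarrow> complex set" where
  "isom_arc1 f = (\<Union>A\<in>f. cball (- (A$2$2) / A$2$1) (1 / cmod (A$2$1))) \<inter> sphere 0 1"

definition isom_arc2 :: "(complex^2^2) set \<Rightarrow> complex set" where
  "isom_arc2 f = (\<Union>A\<in>f. cball (A$1$1 / A$2$1) (1 / cmod (A$2$1))) \<inter> sphere 0 1"

definition fuchs_isom :: "(complex^2^2) set set" where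
  "fuchs_isom = {f \<in> fuchs_group. \<forall>A\<in>f. A$2$1 \<noteq> 0}"

definition circle_arc :: "complex \<Rightarrow> real \<Rightarrow> complex set" where
  "circle_arc m l = {m * cis t | t. \<bar>t\<bar> \<le> l / 2}"

definition has_arcs :: "(complex^2^2) set \<Rightarrow> complex \<Rightarrow> complex \<Rightarrow> real \<Rightarrow> bool" where
  "has_arcs f m1 m2 l \<longleftrightarrow>
     f \<in> fuchs_group \<and> isom_arc1 f = circle_arc m1 l \<and> isom_arc2 f = circle_arc m2 l"

text \<open>Unordered pairs of arcs of equal length. The extreme lengths are left out: no element of
  \<open>fuchs_group\<close> has \<open>1 / cmod a = 0\<close> (length \<open>0\<close>), and \<open>1 / cmod a = 1\<close> (length \<open>pi\<close>)
  forces \<open>c = 0\<close>.\<close>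

definition arc_pairs :: "complex set set set" where
  "arc_pairs = {{circle_arc m1 l, circle_arc m2 l} | m1 m2 l.
     m1 \<in> sphere 0 1 \<and> m2 \<in> sphere 0 1 \<and> 0 < l \<and> l < pi}"

definition pair_elems :: "complex set set \<Rightarrow> (complex^2^2) set set" where
  "pair_elems P = {f \<in> fuchs_group. {isom_arc1 f, isom_arc2 f} = P}"

definition pair_cyclic :: "complex set set \<Rightarrow> (complex^2^2) set set" where
  "pair_cyclic P = generate PSL2C (pair_elems P)"

definition arcs_group :: "nat \<Rightarrow> (nat \<Rightarrow> complex set set) \<Rightarrow> (complex^2^2) set set" where
  "arcs_group n p = generate PSL2C (\<Union>i<n. pair_elems (p i))"

text \<open>An abstract group does not determine its generators (\<open>f\<close>, \<open>g\<close> and \<open>f\<close>, \<open>f g\<close> generate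
  the same group), so an \<open>n\<close>-generator group is a group together with its generators. Arcs do not
  distinguish a generator from its inverse; the generators are therefore recorded up to
  inversion in \<open>marked_groups\<close> and through the cyclic groups they generate in
  \<open>cyclic_marked_groups\<close>. An elliptic generator of finite order is not determined up to inversion
  by its cyclic group, hence the restriction to infinite cyclic groups in the latter.\<close>

definition marked_groups ::
  "nat \<Rightarrow> ((complex^2^2) set set \<times> (nat \<Rightarrow> (complex^2^2) set set)) set" where
  "marked_groups n =
     {(generate PSL2C (f ` {..<n}), \<lambda>i\<in>{..<n}. {f i, inv\<^bsub>PSL2C\<^esub> (f i)}) | f.
        \<forall>i<n. f i \<in> fuchs_isom}"

definition cyclic_marked_groups ::
  "nat \<Rightarrow> ((complex^2^2) set set \<times> (nat \<Rightarrow> (complex^2^2) set set)) set" where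
  "cyclic_marked_groups n =
     {(generate PSL2C (f ` {..<n}), \<lambda>i\<in>{..<n}. cyclic (f i)) | f.
        \<forall>i<n. f i \<in> fuchs_isom \<and> infinite (cyclic (f i))}"

definition corresponds_uniquely :: "(complex^2^2) set set \<Rightarrow> complex set set \<Rightarrow> bool" where
  "corresponds_uniquely C P \<longleftrightarrow>
     infinite C \<and> P \<in> arc_pairs \<and> (\<forall>Q\<in>arc_pairs. pair_cyclic Q = C \<longleftrightarrow> Q = P)"

definition circle_uniform :: "complex measure" where
  "circle_uniform = distr (uniform_measure lborel {0..<2 * pi}) borel cis"

definition uniform_data :: "(complex \<times> complex \<times> real) measure" where
  "uniform_data = circle_uniform \<Otimes>\<^sub>M circle_uniform \<Otimes>\<^sub>M uniform_measure lborel {0..pi}"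

text \<open>The quotient sigma-algebra: \<open>\<Union>B\<close> is the preimage of \<open>B\<close> under \<open>A \<mapsto> {A, - A}\<close>.\<close>

definition fuchs_space :: "(complex^2^2) set measure" where
  "fuchs_space = sigma fuchs_group {B. B \<subseteq> fuchs_group \<and> \<Union>B \<in> sets borel}"

text \<open>\<open>N\<close> is the joint law of \<open>(a, c)\<close>; \<open>sgn a\<close> is \<open>a / cmod a\<close>.\<close>

definition random_coeffs :: "(complex \<times> complex) measure \<Rightarrow> bool" where
  "random_coeffs N \<longleftrightarrow>
     prob_space N \<and> space N = coeffs \<and> sets N = sets (restrict_space borel coeffs) \<and>
     distr N (borel \<Otimes>\<^sub>M borel \<Otimes>\<^sub>M borel)
       (\<lambda>(a, c). (sgn a, sgn c, 2 * arcsin (1 / cmod a))) = uniform_data"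

definition random_element :: "'w measure \<Rightarrow> ('w \<Rightarrow> (complex^2^2) set) \<Rightarrow> bool" where
  "random_element M f \<longleftrightarrow>
     prob_space M \<and> f \<in> measurable M fuchs_space \<and>
     (\<exists>N. random_coeffs N \<and>
        distr M fuchs_space f = distr N fuchs_space (\<lambda>(a, c). fuchs_elem a c))"

definition random_arc_pair ::
  "'w measure \<Rightarrow> ('w \<Rightarrow> complex) \<Rightarrow> ('w \<Rightarrow> complex) \<Rightarrow> ('w \<Rightarrow> real) \<Rightarrow> bool" where
  "random_arc_pair M m1 m2 l \<longleftrightarrow>
     prob_space M \<and> m1 \<in> borel_measurable M \<and> m2 \<in> borel_measurable M \<and>
     l \<in> borel_measurable M \<and>
     distr M (borel \<Otimes>\<^sub>M borel \<Otimes>\<^sub>M borel) (\<lambda>w. (m1 w, m2 w, l w)) = uniform_data"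

definition random_generators ::
  "'w measure \<Rightarrow> nat \<Rightarrow> (nat \<Rightarrow> 'w \<Rightarrow> (complex^2^2) set) \<Rightarrow> bool" where
  "random_generators M n f \<longleftrightarrow>
     prob_space M \<and> (\<forall>i<n. random_element M (f i)) \<and>
     prob_space.indep_vars M (\<lambda>_. fuchs_space) f {..<n}"

definition random_arc_collection ::
  "'w measure \<Rightarrow> nat \<Rightarrow> (nat \<Rightarrow> 'w \<Rightarrow> complex) \<Rightarrow> (nat \<Rightarrow> 'w \<Rightarrow> complex) \<Rightarrow>
    (nat \<Rightarrow> 'w \<Rightarrow> real) \<Rightarrow> bool" where
  "random_arc_collection M n m1 m2 l \<longleftrightarrow>
     prob_space M \<and> (\<forall>i<n. random_arc_pair M (m1 i) (m2 i) (l i)) \<and>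
     prob_space.indep_vars M (\<lambda>_. borel \<Otimes>\<^sub>M borel \<Otimes>\<^sub>M borel)
       (\<lambda>i w. (m1 i w, m2 i w, l i w)) {..<n}"

end

theory Submission
  imports Defs "HOL-Algebra.Multiplicative_Group"
begin

text \<open>The correspondence becomes explicit when the coefficients are written in polar form. Let \<open>u\<close> and
  \<open>v\<close> be the phases of \<open>a\<close> and \<open>c\<close>. Since \<open>(cmod a)\<^sup>2 - (cmod c)\<^sup>2 = 1\<close>, the isometric circles are
  orthogonal to the unit circle, and therefore they cut out arcs with midpoints
  \<open>m1 = - cnj u * v\<close> and \<open>m2 = u * v\<close> and with a length \<open>l\<close> such that \<open>sin (l / 2) = 1 / cmod a\<close>
  (\<open>isom_arcs_fuchs_elem\<close>). Conversely \<open>u\<^sup>2 = - m2 * cnj m1\<close> and \<open>v = m2 * cnj u\<close>, so the arcs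
  determine \<open>(u, v)\<close> up to a common sign, which is the sign ambiguity of a matrix in \<open>PSL2C\<close>. Hence
  \<open>arc_params\<close> is a bijection from the elements with isometric circles onto the triples
  \<open>(m1, m2, l)\<close> with \<open>0 < l < pi\<close> (\<open>inj_on_arc_params\<close>, \<open>arc_elem\<close>).

  Inverting an element exchanges its two arcs, so an unordered pair of arcs stands for an element
  up to inversion (\<open>pair_elems_isom_arcs\<close>). An infinite cyclic group has exactly two generators,
  inverse to each other, and so it carries the same information (\<open>isom_arcs_cyclic_eq\<close>). The two
  bijections between collections of pairs of arcs and groups with marked generators follow
  generator by generator.

  For the random version, the map \<open>(u, v) \<mapsto> (- cnj u * v, u * v)\<close> is a surjective endomorphism of
  the torus followed by a translation, and such a map preserves the uniform measure
  (\<open>distr_phases_to_midpoints\<close>, by Fubini's theorem and the invariance of the uniform law on the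
  circle under rotation and squaring). Uniform phases thus give uniform midpoints, and the length
  is the same variable on both sides (\<open>distr_arc_params\<close>, \<open>random_element_arc_elem\<close>). Independence
  carries over because the arcs are a measurable function of the element and conversely. Finally,
  an element of finite order has an eigenvalue that is a root of unity, so its trace lies in a
  countable set (\<open>trace_finite_order\<close>); given distinct midpoints, this leaves only countably many
  lengths. Almost surely the cyclic group is therefore infinite and determines its pair of arcs
  (\<open>AE_generic_params\<close>, \<open>generic_correspondence\<close>).\<close>

section \<open>The group of cosets\<close>

lemma matrix_2_eq_iff:
  fixes A B :: "'a^2^2"
  shows "A = B \<longleftrightarrow> A$1$1 = B$1$1 \<and> A$1$2 = B$1$2 \<and> A$2$1 = B$2$1 \<and> A$2$2 = B$2$2"
  by (auto simp: vec_eq_iff forall_2)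

lemma matrix_mult_2_nth:
  fixes A B :: "complex^2^2"
  shows "(A ** B)$i$j = A$i$1 * B$1$j + A$i$2 * B$2$j"
  by (simp add: matrix_matrix_mult_def sum_2)

lemma mat_1_2_nth:
  "(mat 1 :: complex^2^2)$1$1 = 1" "(mat 1 :: complex^2^2)$1$2 = 0"
  "(mat 1 :: complex^2^2)$2$1 = 0" "(mat 1 :: complex^2^2)$2$2 = 1"
  by (simp_all add: mat_def)

lemma group_SL2C: "group SL2C"
proof (rule groupI)
  fix A assume "A \<in> carrier SL2C"
  then have d: "A$1$1 * A$2$2 - A$1$2 * A$2$1 = 1"
    by (simp add: SL2C_def det_2)
  let ?B = "vector [vector [A$2$2, - A$1$2], vector [- A$2$1, A$1$1]] :: complex^2^2"
  have "?B ** A = mat 1"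
    using d by (simp add: matrix_2_eq_iff matrix_mult_2_nth mat_1_2_nth algebra_simps)
  moreover have "det ?B = 1"
    using d by (simp add: det_2 algebra_simps)
  ultimately show "\<exists>B\<in>carrier SL2C. B \<otimes>\<^bsub>SL2C\<^esub> A = \<one>\<^bsub>SL2C\<^esub>"
    by (auto simp: SL2C_def intro!: bexI[of _ ?B])
qed (auto simp: SL2C_def det_mul matrix_mul_assoc)

lemma neg_mat_1_mult: "(- mat 1) ** A = - A" "A ** (- mat 1) = - A" for A :: "complex^2^2"
  by (simp_all add: matrix_2_eq_iff matrix_mult_2_nth mat_1_2_nth)

lemma centre_normal_SL2C: "{mat 1, - mat 1} \<lhd> SL2C"
proof -
  interpret group SL2C by (rule group_SL2C)
  have "subgroup {mat 1, - mat 1} SL2C"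
  proof (rule subgroupI)
    have "inv\<^bsub>SL2C\<^esub> (- mat 1) = - mat 1"
      by (rule inv_equality) (auto simp: SL2C_def det_2 mat_1_2_nth neg_mat_1_mult)
    moreover have "inv\<^bsub>SL2C\<^esub> (mat 1) = mat 1"
      by (rule inv_equality) (auto simp: SL2C_def)
    ultimately show "inv\<^bsub>SL2C\<^esub> A \<in> {mat 1, - mat 1}" if "A \<in> {mat 1, - mat 1}" for A
      using that by auto
  qed (auto simp: SL2C_def det_2 mat_1_2_nth neg_mat_1_mult)
  moreover have "A \<otimes>\<^bsub>SL2C\<^esub> Z \<otimes>\<^bsub>SL2C\<^esub> inv\<^bsub>SL2C\<^esub> A \<in> {mat 1, - mat 1}"
    if A: "A \<in> carrier SL2C" and Z: "Z \<in> {mat 1, - mat 1}" for A Z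
  proof -
    have "A \<otimes>\<^bsub>SL2C\<^esub> Z = Z \<otimes>\<^bsub>SL2C\<^esub> A" "Z \<in> carrier SL2C"
      using Z by (auto simp: SL2C_def neg_mat_1_mult det_2 mat_1_2_nth)
    then have "A \<otimes>\<^bsub>SL2C\<^esub> Z \<otimes>\<^bsub>SL2C\<^esub> inv\<^bsub>SL2C\<^esub> A = Z"
      using A by (simp add: m_assoc)
    then show ?thesis using Z by simp
  qed
  ultimately show ?thesis
    unfolding normal_inv_iff by blast
qed

lemma group_PSL2C: "group PSL2C"
  unfolding PSL2C_def by (rule normal.factorgroup_is_group[OF centre_normal_SL2C])

definition fuchs_mat :: "complex \<Rightarrow> complex \<Rightarrow> complex^2^2" where
  "fuchs_mat a c = vector [vector [a, c], vector [cnj c, cnj a]]"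

lemma fuchs_mat_nth [simp]:
  "fuchs_mat a c $ 1 $ 1 = a" "fuchs_mat a c $ 1 $ 2 = c"
  "fuchs_mat a c $ 2 $ 1 = cnj c" "fuchs_mat a c $ 2 $ 2 = cnj a"
  by (simp_all add: fuchs_mat_def)

lemma coeffs_iff: "(a, c) \<in> coeffs \<longleftrightarrow> (cmod a)\<^sup>2 = 1 + (cmod c)\<^sup>2"
  by (auto simp: coeffs_def)

lemma coeffs_cnj_iff: "(a, c) \<in> coeffs \<longleftrightarrow> a * cnj a = 1 + c * cnj c"
proof -
  have "a * cnj a = 1 + c * cnj c \<longleftrightarrow>
    complex_of_real ((cmod a)\<^sup>2) = complex_of_real (1 + (cmod c)\<^sup>2)"
    by (simp only: of_real_add of_real_1 complex_norm_square)
  then show ?thesis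
    by (simp only: coeffs_iff of_real_eq_iff)
qed

lemma fuchs_mat_carrier: "(a, c) \<in> coeffs \<Longrightarrow> fuchs_mat a c \<in> carrier SL2C"
  by (simp add: SL2C_def det_2 coeffs_cnj_iff)

text \<open>Two descriptions of an element of the group: as a coset it is accessible to the theory of
  quotient groups, as a pair of opposite matrices to computation.\<close>

lemma fuchs_elem_coset: "fuchs_elem a c = {mat 1, - mat 1} #>\<^bsub>SL2C\<^esub> fuchs_mat a c"
  by (simp add: fuchs_elem_def fuchs_mat_def)

lemma fuchs_elem_eq: "fuchs_elem a c = {fuchs_mat a c, - fuchs_mat a c}"
  by (auto simp: fuchs_elem_coset r_coset_def SL2C_def neg_mat_1_mult)

lemma fuchs_elem_uminus: "fuchs_elem (- a) (- c) = fuchs_elem a c"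
proof -
  have "fuchs_mat (- a) (- c) = - fuchs_mat a c"
    by (simp add: matrix_2_eq_iff)
  then show ?thesis by (auto simp: fuchs_elem_eq)
qed

lemma fuchs_elem_carrier: "(a, c) \<in> coeffs \<Longrightarrow> fuchs_elem a c \<in> carrier PSL2C"
  unfolding PSL2C_def fuchs_elem_coset by (auto simp: carrier_FactGroup fuchs_mat_carrier)

lemma fuchs_group_carrier: "f \<in> fuchs_group \<Longrightarrow> f \<in> carrier PSL2C"
  by (auto simp: fuchs_group_def fuchs_elem_carrier)

lemma inv_fuchs_elem:
  assumes "(a, c) \<in> coeffs"
  shows "inv\<^bsub>PSL2C\<^esub> (fuchs_elem a c) = fuchs_elem (cnj a) (- c)"
proof (rule group.inv_equality[OF group_PSL2C])
  have c': "(cnj a, - c) \<in> coeffs" using assms by (simp add: coeffs_iff)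
  have "fuchs_mat (cnj a) (- c) ** fuchs_mat a c = mat 1"
    using assms by (simp add: matrix_2_eq_iff matrix_mult_2_nth mat_1_2_nth coeffs_cnj_iff algebra_simps)
  then show "fuchs_elem (cnj a) (- c) \<otimes>\<^bsub>PSL2C\<^esub> fuchs_elem a c = \<one>\<^bsub>PSL2C\<^esub>"
    using normal.rcos_sum[OF centre_normal_SL2C fuchs_mat_carrier[OF c'] fuchs_mat_carrier[OF assms]]
    by (simp add: PSL2C_def fuchs_elem_coset)
      (simp add: SL2C_def r_coset_def insert_commute)
qed (use assms in \<open>auto simp: fuchs_elem_carrier coeffs_iff\<close>)

lemma fuchs_isom_iff:
  assumes "(a, c) \<in> coeffs"
  shows "fuchs_elem a c \<in> fuchs_isom \<longleftrightarrow> c \<noteq> 0"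
proof -
  have "fuchs_elem a c \<in> fuchs_group"
    using assms unfolding fuchs_group_def by blast
  then show ?thesis
    by (simp add: fuchs_isom_def) (simp add: fuchs_elem_eq)
qed

lemma fuchs_isomE:
  assumes "f \<in> fuchs_isom"
  obtains a c where "f = fuchs_elem a c" "(a, c) \<in> coeffs" "c \<noteq> 0"
proof -
  obtain a c where "(a, c) \<in> coeffs" "f = fuchs_elem a c"
    using assms unfolding fuchs_isom_def fuchs_group_def by blast
  with assms fuchs_isom_iff that show thesis by blast
qed

text \<open>An infinite cyclic group is isomorphic to the integers, whose only generators are \<open>1\<close> and
  \<open>-1\<close>: if \<open>f\<close> and \<open>g\<close> are powers of each other, the product of the exponents is \<open>1\<close>.\<close>

lemma (in group) infinite_cyclic_generators:
  assumes f: "f \<in> carrier G" and g: "g \<in> carrier G"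
    and inf: "infinite (generate G {f})" and eq: "generate G {g} = generate G {f}"
  shows "g = f \<or> g = inv f"
proof -
  have "f \<in> generate G {g}" "g \<in> generate G {f}"
    using eq by (auto intro: generate.incl)
  then obtain j k :: int where j: "f = g [^] j" and k: "g = f [^] k"
    unfolding generate_pow[OF f] generate_pow[OF g] by auto
  have "ord f = 0"
    using inf generate_pow_card[OF f] by simp
  moreover have "f [^] (k * j) = f [^] (1::int)"
    using j k int_pow_pow[OF f, of k j] int_pow_1[OF f] by metis
  ultimately have "k * j = 1"
    using int_pow_eq[OF f, of "k * j" 1] by simp
  then have "k = 1 \<or> k = - 1"
    by (simp add: zmult_eq_1_iff) blast
  then show ?thesis
    using k int_pow_neg[OF f, of 1] int_pow_1[OF f] by metis
qed

lemma (in group) generate_inv_invariant: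
  assumes S: "S \<subseteq> carrier G" and T: "S \<subseteq> T" "T \<subseteq> S \<union> m_inv G ` S"
  shows "generate G T = generate G S"
proof
  have "T \<subseteq> generate G S"
    using T(2) by (auto intro: generate.incl generate.inv)
  then show "generate G T \<subseteq> generate G S"
    by (intro generate_subgroup_incl generate_is_subgroup S)
  show "generate G S \<subseteq> generate G T"
    using T(1) by (rule mono_generate)
qed

section \<open>Elements of finite order\<close>

text \<open>A matrix of determinant 1 with eigenvalue \<open>z\<close> has the second eigenvalue \<open>1 / z\<close>, so these are
  the traces that go with eigenvalues of finite order.\<close>

definition torsion_traces :: "complex set" where
  "torsion_traces = (\<lambda>z. z + 1 / z) ` {z. \<exists>k>0. z ^ k = 1}"

lemma countable_torsion_traces: "countable torsion_traces"
proof -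
  have "{z::complex. \<exists>k>0. z ^ k = 1} = (\<Union>k\<in>{0<..}. {z. z ^ k = 1})"
    by auto
  moreover have "countable {z::complex. z ^ k = 1}" if "0 < k" for k
    using that by (intro countable_finite finite_roots_unity) auto
  ultimately show ?thesis
    unfolding torsion_traces_def by (intro countable_image) auto
qed

text \<open>If some power of the coset is trivial, some power of the matrix is \<open>mat 1\<close> or \<open>- mat 1\<close>, and
  applying it to an eigenvector shows that the eigenvalue is a root of unity. Elements of finite
  order therefore have their trace in a countable set, which is what makes them negligible for a
  random element.\<close>

lemma trace_finite_order:
  assumes ac: "(a, c) \<in> coeffs" and c: "c \<noteq> 0" and fin: "finite (cyclic (fuchs_elem a c))"
  shows "complex_of_real (2 * Re a) \<in> torsion_traces"
proof -
  interpret P: group PSL2C by (rule group_PSL2C)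
  interpret S: group SL2C by (rule group_SL2C)
  let ?f = "fuchs_elem a c" and ?A = "fuchs_mat a c"
  have fc: "?f \<in> carrier PSL2C" and Ac: "?A \<in> carrier SL2C"
    using ac by (simp_all add: fuchs_elem_carrier fuchs_mat_carrier)
  have "?f \<in> cyclic ?f" by (rule generate.incl) simp
  then have "P.ord ?f \<noteq> 0"
    using fin P.generate_pow_card[OF fc] by auto
  moreover have "?f [^]\<^bsub>PSL2C\<^esub> P.ord ?f = \<one>\<^bsub>PSL2C\<^esub>"
    using fc by simp
  ultimately obtain k :: nat where k: "k > 0" "?f [^]\<^bsub>PSL2C\<^esub> k = \<one>\<^bsub>PSL2C\<^esub>"
    by blast
  have "{mat 1, - mat 1} #>\<^bsub>SL2C\<^esub> (?A [^]\<^bsub>SL2C\<^esub> k) = {mat 1, - mat 1}"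
    using k(2) normal.FactGroup_pow[OF centre_normal_SL2C Ac, of k]
    by (simp add: PSL2C_def fuchs_elem_coset)
  then have Ak: "?A [^]\<^bsub>SL2C\<^esub> k \<in> {mat 1, - mat 1}"
    using S.coset_join1 S.nat_pow_closed[OF Ac] normal.axioms(1)[OF centre_normal_SL2C] by blast
  define t where "t = complex_of_real (2 * Re a)"
  define z where "z = t / 2 + csqrt ((t / 2)\<^sup>2 - 1)"
  have "(z - t / 2)\<^sup>2 = (t / 2)\<^sup>2 - 1"
    by (simp add: z_def)
  then have char: "z\<^sup>2 - t * z + 1 = 0"
    by (simp add: power2_diff power_divide) (simp add: algebra_simps)
  have "t = a + cnj a"
    by (simp add: t_def complex_add_cnj)
  \<comment> \<open>an eigenvector for the eigenvalue \<open>z\<close>, nonzero because \<open>c\<close> is\<close>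
  define v :: "complex^2" where "v = vector [c, z - a]"
  have "a * cnj a = 1 + c * cnj c" using ac by (simp add: coeffs_cnj_iff)
  then have "c * cnj c + cnj a * (z - a) = z * (z - a)"
    using char \<open>t = a + cnj a\<close> by (simp add: power2_eq_square algebra_simps)
  then have Av: "?A *v v = z *s v"
    by (simp add: vec_eq_iff forall_2 v_def matrix_vector_mult_def sum_2 algebra_simps)
  have pow: "(?A [^]\<^bsub>SL2C\<^esub> n) *v v = z ^ n *s v" for n :: nat
  proof (induction n)
    case 0 then show ?case by (simp add: SL2C_def)
  next
    case (Suc n)
    have "(?A [^]\<^bsub>SL2C\<^esub> Suc n) *v v = (?A [^]\<^bsub>SL2C\<^esub> n) *v (?A *v v)"
      by (simp add: SL2C_def matrix_vector_mul_assoc)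
    also have "\<dots> = z *s ((?A [^]\<^bsub>SL2C\<^esub> n) *v v)"
      by (simp add: Av vector_scalar_commute)
    finally show ?case using Suc by simp
  qed
  have "z ^ k * c = c \<or> z ^ k * c = - c"
    using Ak arg_cong[OF pow[of k], of "\<lambda>x. x$1"]
    by (auto simp: v_def matrix_vector_mult_def sum_2 mat_1_2_nth)
  then have "z ^ k = 1 \<or> z ^ k = - 1"
    using c by (metis mult_cancel_right1 mult_minus1 mult_right_cancel)
  then have "z ^ (2 * k) = 1"
    by (metis mult.commute power_mult power2_minus power_one)
  moreover have "z + 1 / z = t"
  proof -
    have "z \<noteq> 0" using char by auto
    then show ?thesis using char by (simp add: field_simps power2_eq_square)
  qed
  ultimately show ?thesis
    unfolding torsion_traces_def t_def[symmetric] using k(1)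
    by (intro image_eqI[of _ _ z]) (auto intro!: exI[of _ "2 * k"])
qed

section \<open>Arcs and isometric circles\<close>

text \<open>An arc is the part of the circle in a half plane orthogonal to its midpoint. In this form it
  can be compared both with other arcs and with disks.\<close>

lemma circle_arc_eq:
  assumes m: "cmod m = 1" and l: "0 \<le> l" "l \<le> 2 * pi"
  shows "circle_arc m l = {z. cmod z = 1 \<and> cos (l / 2) \<le> Re (z * cnj m)}"
proof (intro Set.set_eqI iffI)
  have mm: "m * cnj m = 1"
    using m by (simp add: complex_norm_square[symmetric])
  fix z
  {
    assume "z \<in> circle_arc m l"
    then obtain t where t: "z = m * cis t" "\<bar>t\<bar> \<le> l / 2"
      by (auto simp: circle_arc_def)
    have "z * cnj m = (m * cnj m) * cis t"
      using t(1) by (simp add: mult_ac)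
    then have "Re (z * cnj m) = cos t"
      by (simp add: mm)
    moreover have "cos (l / 2) \<le> cos \<bar>t\<bar>"
      using t(2) l by (intro cos_monotone_0_pi_le) auto
    moreover have "cmod z = 1"
      using t(1) m by (simp add: norm_mult)
    ultimately show "z \<in> {z. cmod z = 1 \<and> cos (l / 2) \<le> Re (z * cnj m)}"
      by simp
  next
    assume z: "z \<in> {z. cmod z = 1 \<and> cos (l / 2) \<le> Re (z * cnj m)}"
    define t where "t = Arg (z * cnj m)"
    have "cmod (z * cnj m) = 1"
      using z m by (simp add: norm_mult)
    then have t: "z * cnj m = cis t"
      using rcis_cmod_Arg[of "z * cnj m"] by (simp add: t_def rcis_def)
    have "Re (z * cnj m) = cos t"
      unfolding t by simp
    then have "cos (l / 2) \<le> cos \<bar>t\<bar>"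
      using z by simp
    moreover have "\<bar>t\<bar> \<le> pi"
      using Arg_bounded[of "z * cnj m"] by (auto simp: t_def)
    ultimately have "\<bar>t\<bar> \<le> l / 2"
      using l cos_mono_le_eq[of "l / 2" "\<bar>t\<bar>"] by simp
    moreover have "z = m * cis t"
      using t mm by (metis mult.assoc mult.commute mult.right_neutral)
    ultimately show "z \<in> circle_arc m l"
      by (auto simp: circle_arc_def)
  }
qed

lemma Re_mult_cnj_le_1:
  assumes "cmod z = 1" "cmod m = 1"
  shows "Re (z * cnj m) \<le> 1" and "Re (z * cnj m) = 1 \<Longrightarrow> z = m"
proof -
  have n: "cmod (z * cnj m) = 1"
    using assms by (simp add: norm_mult)
  then show "Re (z * cnj m) \<le> 1"
    using complex_Re_le_cmod[of "z * cnj m"] by simp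
  assume R: "Re (z * cnj m) = 1"
  then have "Im (z * cnj m) = 0"
    using n cmod_power2[of "z * cnj m"] by simp
  with R have "z * cnj m = 1"
    by (simp only: complex_eq_iff) simp
  moreover have "m * cnj m = 1"
    using assms by (simp add: complex_norm_square[symmetric])
  ultimately show "z = m"
    by (metis mult.assoc mult.commute mult.right_neutral)
qed

text \<open>Both endpoints of either arc lie in the half plane that cuts out the other. Adding the two
  inequalities makes the sines cancel and leaves \<open>cos (l / 2) \<le> r * cos (l' / 2)\<close> and its mirror
  image, where \<open>r \<le> 1\<close> is the cosine of the angle between the midpoints. As the cosines of the
  half lengths are positive, equality must hold everywhere.\<close>

lemma circle_arc_inject:
  assumes m: "cmod m = 1" "cmod m' = 1"
    and l: "0 < l" "l < pi" "0 < l'" "l' < pi"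
  shows "circle_arc m l = circle_arc m' l' \<longleftrightarrow> m = m' \<and> l = l'"
proof
  assume eq: "circle_arc m l = circle_arc m' l'"
  define r where "r = Re (m' * cnj m)"
  have key: "cos (k / 2) \<le> Re (p' * cnj p) * cos (k' / 2)"
    if "circle_arc p k = circle_arc p' k'" "cmod p = 1" "0 < k" "k < pi" "0 < k'"
    for p p' k k'
  proof -
    have "p' * cis t \<in> circle_arc p k" if "\<bar>t\<bar> \<le> k' / 2" for t
      using that unfolding \<open>circle_arc p k = circle_arc p' k'\<close> by (auto simp: circle_arc_def)
    from this[of "k' / 2"] this[of "- (k' / 2)"]
    have "p' * cis (k' / 2) \<in> circle_arc p k" "p' * cis (- (k' / 2)) \<in> circle_arc p k"
      using \<open>0 < k'\<close> by simp_all
    then have "cos (k / 2) \<le> Re (p' * cis (k' / 2) * cnj p)"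
      "cos (k / 2) \<le> Re (p' * cis (- (k' / 2)) * cnj p)"
      using circle_arc_eq[of p k] that by auto
    then show ?thesis by (simp add: algebra_simps)
  qed
  have c: "cos (l / 2) > 0" "cos (l' / 2) > 0"
    using l by (simp_all add: cos_gt_zero)
  have 1: "cos (l / 2) \<le> r * cos (l' / 2)"
    using key[OF eq m(1)] l by (simp add: r_def)
  have 2: "cos (l' / 2) \<le> r * cos (l / 2)"
    using key[OF eq[symmetric] m(2)] l by (simp add: r_def algebra_simps)
  have r: "r \<le> 1"
    unfolding r_def by (rule Re_mult_cnj_le_1(1)[OF m(2,1)])
  have 3: "r * cos (l / 2) \<le> cos (l / 2)" "r * cos (l' / 2) \<le> cos (l' / 2)"
    using r c by simp_all
  with 1 2 have cc: "cos (l / 2) = cos (l' / 2)" "r * cos (l / 2) = cos (l / 2)"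
    by linarith+
  then have "r = 1" using c by (metis less_irrefl mult_cancel_right2)
  then have "m = m'"
    using Re_mult_cnj_le_1(2)[OF m(2,1)] by (simp add: r_def)
  moreover have "l = l'"
    using cc(1) cos_inj_pi[of "l / 2" "l' / 2"] l by simp
  ultimately show "m = m' \<and> l = l'" by simp
qed simp

text \<open>The equation \<open>q\<^sup>2 = 1 + r\<^sup>2\<close> says that the circle with centre \<open>q * m\<close> and radius \<open>r\<close> is
  orthogonal to the unit circle. The intersection points then lie on the polar line of the
  centre, at distance \<open>1 / q\<close> from the origin.\<close>

lemma cball_Int_unit_circle:
  assumes m: "cmod m = 1" and q: "q > 0" and r: "r \<ge> 0" and orth: "q\<^sup>2 = 1 + r\<^sup>2"
  shows "cball (of_real q * m) r \<inter> sphere 0 1 = {z. cmod z = 1 \<and> 1 / q \<le> Re (z * cnj m)}"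
proof -
  have "dist (of_real q * m) z \<le> r \<longleftrightarrow> 1 / q \<le> Re (z * cnj m)" if z: "cmod z = 1" for z
  proof -
    have "(dist (of_real q * m) z)\<^sup>2 = (cmod z)\<^sup>2 + q\<^sup>2 * (cmod m)\<^sup>2 - 2 * q * Re (z * cnj m)"
      unfolding dist_norm cmod_power2 by (simp add: power2_eq_square algebra_simps)
    then have "(dist (of_real q * m) z)\<^sup>2 = r\<^sup>2 + 2 - 2 * q * Re (z * cnj m)"
      by (simp add: z m orth)
    moreover have "dist (of_real q * m) z \<le> r \<longleftrightarrow> (dist (of_real q * m) z)\<^sup>2 \<le> r\<^sup>2"
      using r by (simp add: power2_le_iff_abs_le)
    ultimately have "dist (of_real q * m) z \<le> r \<longleftrightarrow> 1 \<le> Re (z * cnj m) * q"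
      by (auto simp: mult_ac simp del: times_complex.sel)
    then show ?thesis
      using q by (simp only: pos_divide_le_eq)
  qed
  then show ?thesis
    by auto
qed

definition coeff_polar :: "complex \<times> complex \<Rightarrow> complex \<times> complex \<times> real" where
  "coeff_polar = (\<lambda>(a, c). (sgn a, sgn c, 2 * arcsin (1 / cmod a)))"

definition phases_to_midpoints :: "complex \<times> complex \<times> real \<Rightarrow> complex \<times> complex \<times> real" where
  "phases_to_midpoints = (\<lambda>(u, v, l). (- cnj u * v, u * v, l))"

text \<open>The midpoints and the length of the two arcs of an element with isometric circles. The formula
  is invariant under a change of sign of the matrix, so the choice of a representative does not
  matter.\<close>

definition arc_params :: "(complex^2^2) set \<Rightarrow> complex \<times> complex \<times> real" where
  "arc_params f = (let A = SOME A. A \<in> f in phases_to_midpoints (coeff_polar (A$1$1, A$1$2)))"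

lemma phases_to_midpoints_uminus:
  "phases_to_midpoints (coeff_polar (- a, - c)) = phases_to_midpoints (coeff_polar (a, c))"
  by (simp add: phases_to_midpoints_def coeff_polar_def sgn_minus)

lemma arc_params_eqI:
  assumes f: "f \<in> fuchs_group" and A: "A \<in> f"
  shows "arc_params f = phases_to_midpoints (coeff_polar (A$1$1, A$1$2))"
proof -
  obtain a c where ac: "f = fuchs_elem a c"
    using f by (auto simp: fuchs_group_def)
  have *: "phases_to_midpoints (coeff_polar (B$1$1, B$1$2)) =
      phases_to_midpoints (coeff_polar (a, c))" if "B \<in> f" for B
    using that by (auto simp: ac fuchs_elem_eq phases_to_midpoints_uminus)
  have "(SOME A. A \<in> f) \<in> f"
    using A by (rule someI)
  then show ?thesis
    unfolding arc_params_def Let_def using *[OF A] * by simp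
qed

lemma arc_params_fuchs_elem:
  assumes "(a, c) \<in> coeffs"
  shows "arc_params (fuchs_elem a c) = phases_to_midpoints (coeff_polar (a, c))"
proof -
  have "fuchs_elem a c \<in> fuchs_group" "fuchs_mat a c \<in> fuchs_elem a c"
    using assms by (auto simp: fuchs_group_def fuchs_elem_eq)
  from arc_params_eqI[OF this] show ?thesis by simp
qed

definition arc_domain :: "(complex \<times> complex \<times> real) set" where
  "arc_domain = {(m1, m2, l). cmod m1 = 1 \<and> cmod m2 = 1 \<and> 0 < l \<and> l < pi}"

lemma cmod_coeffs:
  assumes "(a, c) \<in> coeffs"
  shows "1 \<le> cmod a" and "c \<noteq> 0 \<longleftrightarrow> 1 < cmod a"
proof -
  have eq: "(cmod a)\<^sup>2 = 1 + (cmod c)\<^sup>2"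
    using assms by (simp add: coeffs_iff)
  then show "1 \<le> cmod a"
    by (intro power2_le_imp_le[of 1]) auto
  show "c \<noteq> 0 \<longleftrightarrow> 1 < cmod a"
  proof
    assume "c \<noteq> 0"
    then show "1 < cmod a"
      using eq by (intro power2_less_imp_less[of 1]) auto
  next
    assume "1 < cmod a"
    then have "1 < (cmod a)\<^sup>2" by simp
    then show "c \<noteq> 0" using eq by auto
  qed
qed

lemma cos_arcsin_inverse_cmod:
  assumes ac: "(a, c) \<in> coeffs"
  shows "cos (arcsin (1 / cmod a)) = cmod c / cmod a"
proof -
  have a: "1 \<le> cmod a" using cmod_coeffs[OF ac] by simp
  have "cos (arcsin (1 / cmod a)) = sqrt (1 - (1 / cmod a)\<^sup>2)"
    using a by (intro cos_arcsin) (auto simp: divide_simps)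
  also have "1 - (1 / cmod a)\<^sup>2 = (cmod c / cmod a)\<^sup>2"
  proof -
    have "(cmod a)\<^sup>2 \<noteq> 0" using a by auto
    then show ?thesis
      using ac unfolding coeffs_iff power_divide by (simp add: field_simps)
  qed
  finally show ?thesis by simp
qed

text \<open>The centres \<open>- cnj a / cnj c\<close> and \<open>a / cnj c\<close> have modulus \<open>cmod a / cmod c\<close>, the radius is
  \<open>1 / cmod c\<close>, and \<open>(cmod a)\<^sup>2 = 1 + (cmod c)\<^sup>2\<close> is exactly the orthogonality of the isometric
  circles to the unit circle. Hence the half length of both arcs has cosine
  \<open>cmod c / cmod a\<close> and sine \<open>1 / cmod a\<close>, and the midpoints are the directions of the centres.\<close>

lemma isom_arcs_fuchs_elem:
  assumes ac: "(a, c) \<in> coeffs" and c: "c \<noteq> 0"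
    and p: "arc_params (fuchs_elem a c) = (m1, m2, l)"
  shows "(m1, m2, l) \<in> arc_domain" and "isom_arc1 (fuchs_elem a c) = circle_arc m1 l"
    and "isom_arc2 (fuchs_elem a c) = circle_arc m2 l"
proof -
  have m: "m1 = - cnj (sgn a) * sgn c" "m2 = sgn a * sgn c" and l: "l = 2 * arcsin (1 / cmod a)"
    using p by (simp_all add: arc_params_fuchs_elem[OF ac] phases_to_midpoints_def coeff_polar_def)
  have a: "1 < cmod a" "a \<noteq> 0"
    using cmod_coeffs[OF ac] c by auto
  have l_bounds: "0 < l" "l < pi"
  proof -
    have "arcsin 0 < arcsin (1 / cmod a)" "arcsin (1 / cmod a) < arcsin 1"
      using a by (intro arcsin_less_arcsin; simp add: field_simps)+
    then show "0 < l" "l < pi" by (simp_all add: l)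
  qed
  have m_cmod: "cmod m1 = 1" "cmod m2 = 1"
    using a c by (simp_all add: m norm_mult norm_sgn)
  with l_bounds show "(m1, m2, l) \<in> arc_domain"
    by (simp add: arc_domain_def)
  define q where "q = cmod a / cmod c"
  have q: "q > 0" "1 / q = cos (l / 2)"
    using a c by (simp_all add: q_def l cos_arcsin_inverse_cmod[OF ac])
  have orth: "q\<^sup>2 = 1 + (1 / cmod c)\<^sup>2"
  proof -
    have "(cmod c)\<^sup>2 \<noteq> 0" using c by simp
    then show ?thesis
      using ac unfolding q_def coeffs_iff power_divide by (simp add: field_simps)
  qed
  have disk: "cball (of_real q * m) (1 / cmod c) \<inter> sphere 0 1 = circle_arc m l"
    if "cmod m = 1" for m
    using cball_Int_unit_circle[OF that q(1) _ orth] circle_arc_eq[OF that, of l] q(2) l_bounds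
    by simp
  have sc: "sgn c = of_real (cmod c) / cnj c"
  proof -
    have "c * cnj c = of_real (cmod c) * of_real (cmod c)"
      by (simp add: complex_norm_square[symmetric] power2_eq_square)
    then show ?thesis
      using c by (simp add: sgn_eq field_simps)
  qed
  have centre1: "- cnj a / cnj c = of_real q * m1"
    unfolding m q_def sc using a c by (simp add: sgn_eq)
  have centre2: "a / cnj c = of_real q * m2"
    unfolding m q_def sc using a c by (simp add: sgn_eq)
  show "isom_arc1 (fuchs_elem a c) = circle_arc m1 l"
    using disk[OF m_cmod(1)] unfolding centre1[symmetric]
    by (simp add: isom_arc1_def fuchs_elem_eq)
  show "isom_arc2 (fuchs_elem a c) = circle_arc m2 l"
    using disk[OF m_cmod(2)] unfolding centre2[symmetric]
    by (simp add: isom_arc2_def fuchs_elem_eq)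
qed

lemma has_arcs_iff:
  assumes dom: "(m1, m2, l) \<in> arc_domain"
  shows "has_arcs f m1 m2 l \<longleftrightarrow> f \<in> fuchs_isom \<and> arc_params f = (m1, m2, l)"
proof
  assume h: "has_arcs f m1 m2 l"
  then obtain a c where f: "f = fuchs_elem a c" and ac: "(a, c) \<in> coeffs"
    unfolding has_arcs_def fuchs_group_def by blast
  have "m1 \<in> circle_arc m1 l"
    using dom by (auto simp: circle_arc_def arc_domain_def intro!: exI[of _ 0])
  then have "m1 \<in> isom_arc1 f"
    using h by (simp add: has_arcs_def)
  \<comment> \<open>for \<open>c = 0\<close> both disks are the point \<open>0\<close>, which is not on the circle\<close>
  then have c: "c \<noteq> 0"
    by (auto simp: isom_arc1_def f fuchs_elem_eq)
  obtain n1 n2 k where p: "arc_params f = (n1, n2, k)"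
    by (cases "arc_params f")
  note isom_arcs_fuchs_elem[OF ac c p[unfolded f], folded f]
  then have "n1 = m1 \<and> k = l" "n2 = m2 \<and> k = l"
    using h dom circle_arc_inject[of n1 m1 k l] circle_arc_inject[of n2 m2 k l]
    by (simp_all add: has_arcs_def arc_domain_def)
  then show "f \<in> fuchs_isom \<and> arc_params f = (m1, m2, l)"
    using p f c ac fuchs_isom_iff by blast
next
  assume f: "f \<in> fuchs_isom \<and> arc_params f = (m1, m2, l)"
  then obtain a c where ac: "f = fuchs_elem a c" "(a, c) \<in> coeffs" "c \<noteq> 0"
    by (blast elim: fuchs_isomE)
  show "has_arcs f m1 m2 l"
    using f isom_arcs_fuchs_elem(2,3)[OF ac(2,3)] unfolding ac(1) has_arcs_def fuchs_isom_def by blast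
qed

lemma arc_params_in_domain: "f \<in> fuchs_isom \<Longrightarrow> arc_params f \<in> arc_domain"
  using isom_arcs_fuchs_elem(1) by (metis fuchs_isomE prod_cases3)

text \<open>The midpoints determine the square of the phase of \<open>a\<close>, and that phase then determines the
  phase of \<open>c\<close>: the remaining ambiguity is a common sign, which is invisible in the coset.\<close>

lemma phases_from_midpoints:
  assumes ac: "(a, c) \<in> coeffs" and c: "c \<noteq> 0"
    and p: "arc_params (fuchs_elem a c) = (m1, m2, l)"
  shows "(sgn a)\<^sup>2 = - m2 * cnj m1" and "sgn c = m2 * cnj (sgn a)" and "sin (l / 2) = 1 / cmod a"
proof -
  have m: "m1 = - cnj (sgn a) * sgn c" "m2 = sgn a * sgn c" and l: "l = 2 * arcsin (1 / cmod a)"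
    using p by (simp_all add: arc_params_fuchs_elem[OF ac] phases_to_midpoints_def coeff_polar_def)
  have a: "1 < cmod a" "a \<noteq> 0"
    using cmod_coeffs[OF ac] c by auto
  have uu: "sgn a * cnj (sgn a) = 1" and vv: "sgn c * cnj (sgn c) = 1"
    using a c by (simp_all add: complex_norm_square[symmetric] norm_sgn)
  have "- m2 * cnj m1 = (sgn a)\<^sup>2 * (sgn c * cnj (sgn c))"
    by (simp add: m power2_eq_square)
  then show "(sgn a)\<^sup>2 = - m2 * cnj m1"
    by (simp add: vv)
  have "m2 * cnj (sgn a) = sgn c * (sgn a * cnj (sgn a))"
    by (simp add: m)
  then show "sgn c = m2 * cnj (sgn a)"
    by (simp only: uu) simp
  show "sin (l / 2) = 1 / cmod a"
    using a by (simp add: l field_simps)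
qed

lemma inj_on_arc_params: "inj_on arc_params fuchs_isom"
proof (rule inj_onI)
  fix f g assume "f \<in> fuchs_isom" "g \<in> fuchs_isom" and eq: "arc_params f = arc_params g"
  then obtain a c b d where f: "f = fuchs_elem a c" "(a, c) \<in> coeffs" "c \<noteq> 0"
    and g: "g = fuchs_elem b d" "(b, d) \<in> coeffs" "d \<noteq> 0"
    by (metis fuchs_isomE)
  obtain m1 m2 l where p: "arc_params (fuchs_elem a c) = (m1, m2, l)"
    by (metis prod_cases3)
  note pf = phases_from_midpoints[OF f(2,3) p]
  note pg = phases_from_midpoints[OF g(2,3) p[folded f(1), unfolded eq g(1)]]
  have norm_a: "cmod a = cmod b"
    using pf(3) pg(3) by simp
  moreover have "(cmod c)\<^sup>2 = (cmod d)\<^sup>2"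
    using f(2) g(2) norm_a by (simp add: coeffs_iff)
  ultimately have norms: "cmod a = cmod b" "cmod c = cmod d"
    by (simp_all add: power2_eq_iff_nonneg)
  have dec: "z = of_real (cmod z) * sgn z" for z :: complex
    by (cases "z = 0") (simp_all add: sgn_eq)
  have "(sgn a)\<^sup>2 = (sgn b)\<^sup>2" using pf(1) pg(1) by simp
  then consider "sgn a = sgn b" | "sgn a = - sgn b"
    by (auto simp: power2_eq_iff)
  then show "f = g"
  proof cases
    case 1
    then have "sgn c = sgn d" using pf(2) pg(2) by simp
    then have "a = b" "c = d" using 1 norms dec by metis+
    then show ?thesis by (simp add: f g)
  next
    case 2
    then have "sgn c = - sgn d" using pf(2) pg(2) by simp
    then have "a = - b" "c = - d" using 2 norms dec mult_minus_right by metis+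
    then show ?thesis by (simp add: f g fuchs_elem_uminus)
  qed
qed

text \<open>The default value only has to lie in \<open>coeffs\<close>, so that the function takes all its values there.\<close>

definition polar_coeff :: "complex \<times> complex \<times> real \<Rightarrow> complex \<times> complex" where
  "polar_coeff = (\<lambda>(u, v, l). if (u, v, l) \<in> arc_domain
     then (u / of_real (sin (l / 2)), v * of_real (cot (l / 2))) else (1, 0))"

definition midpoints_to_phases :: "complex \<times> complex \<times> real \<Rightarrow> complex \<times> complex \<times> real" where
  "midpoints_to_phases = (\<lambda>(m1, m2, l). let u = csqrt (- m2 * cnj m1) in (u, m2 * cnj u, l))"

definition arc_elem :: "complex \<times> complex \<times> real \<Rightarrow> (complex^2^2) set" where
  "arc_elem x = (\<lambda>(a, c). fuchs_elem a c) (polar_coeff (midpoints_to_phases x))"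

lemma polar_coeff_in_coeffs: "polar_coeff x \<in> coeffs"
proof (cases x)
  case (fields u v l)
  show ?thesis
  proof (cases "x \<in> arc_domain")
    case True
    then have d: "cmod u = 1" "cmod v = 1" "0 < l" "l < pi"
      by (simp_all add: fields arc_domain_def)
    have s: "sin (l / 2) > 0"
      using d by (intro sin_gt_zero) auto
    have "(1 / sin (l / 2))\<^sup>2 = 1 + (cot (l / 2))\<^sup>2"
    proof -
      have "(sin (l / 2))\<^sup>2 \<noteq> 0" using s by simp
      then show ?thesis
        using sin_cos_squared_add[of "l / 2"]
        unfolding cot_def power_divide by (simp add: field_simps)
    qed
    then show ?thesis
      using True d by (simp add: fields polar_coeff_def coeffs_iff norm_divide norm_mult power_divide)
  qed (simp add: fields polar_coeff_def coeffs_iff)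
qed

lemma coeff_polar_polar_coeff:
  assumes "x \<in> arc_domain"
  shows "coeff_polar (polar_coeff x) = x" and "snd (polar_coeff x) \<noteq> 0"
proof -
  obtain u v l where x: "x = (u, v, l)" by (cases x)
  have d: "cmod u = 1" "cmod v = 1" "0 < l" "l < pi"
    using assms by (simp_all add: x arc_domain_def)
  have s: "sin (l / 2) > 0"
    using d by (intro sin_gt_zero) auto
  have t: "cot (l / 2) > 0"
    unfolding cot_def using d by (intro divide_pos_pos s cos_gt_zero) auto
  have su: "sgn (u / of_real (sin (l / 2))) = u"
    using s d by (simp add: sgn_eq norm_divide)
  have sv: "sgn (v * of_real (cot (l / 2))) = v"
    using t d by (simp add: sgn_eq norm_mult)
  have "arcsin (sin (l / 2)) = l / 2"
    using d by (intro arcsin_sin) auto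
  moreover have pc: "polar_coeff x = (u / of_real (sin (l / 2)), v * of_real (cot (l / 2)))"
    using assms by (simp add: x polar_coeff_def)
  ultimately show "coeff_polar (polar_coeff x) = x"
    unfolding pc coeff_polar_def prod.case su sv using s d by (simp add: x norm_divide)
  show "snd (polar_coeff x) \<noteq> 0"
    using t assms d by (auto simp: x polar_coeff_def)
qed

lemma polar_coeff_fuchs_elem:
  assumes "x \<in> arc_domain"
  shows "(\<lambda>(a, c). fuchs_elem a c) (polar_coeff x) \<in> fuchs_isom"
    and "arc_params ((\<lambda>(a, c). fuchs_elem a c) (polar_coeff x)) = phases_to_midpoints x"
proof -
  obtain a c where ac: "polar_coeff x = (a, c)" by (cases "polar_coeff x")
  have "(a, c) \<in> coeffs" "c \<noteq> 0"
    using polar_coeff_in_coeffs[of x] coeff_polar_polar_coeff(2)[OF assms] ac by simp_all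
  then show "(\<lambda>(a, c). fuchs_elem a c) (polar_coeff x) \<in> fuchs_isom"
    and "arc_params ((\<lambda>(a, c). fuchs_elem a c) (polar_coeff x)) = phases_to_midpoints x"
    using coeff_polar_polar_coeff(1)[OF assms] ac
    by (simp_all add: fuchs_isom_iff arc_params_fuchs_elem)
qed

lemma midpoints_to_phases:
  assumes "x \<in> arc_domain"
  shows "midpoints_to_phases x \<in> arc_domain"
    and "phases_to_midpoints (midpoints_to_phases x) = x"
proof -
  obtain m1 m2 l where x: "x = (m1, m2, l)" by (cases x)
  define u where "u = csqrt (- m2 * cnj m1)"
  have d: "cmod m1 = 1" "cmod m2 = 1" "0 < l" "l < pi"
    using assms by (simp_all add: x arc_domain_def)
  have u: "u\<^sup>2 = - m2 * cnj m1"
    by (simp add: u_def)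
  have nu: "cmod u = 1"
    using d by (simp add: u_def norm_mult)
  have p: "midpoints_to_phases x = (u, m2 * cnj u, l)"
    by (simp add: midpoints_to_phases_def x u_def Let_def)
  show "midpoints_to_phases x \<in> arc_domain"
    using d nu by (simp add: p arc_domain_def norm_mult)
  have uu: "u * cnj u = 1" and mm: "m2 * cnj m2 = 1"
    using nu d by (simp_all add: complex_norm_square[symmetric])
  have "- cnj u * (m2 * cnj u) = - m2 * cnj (u\<^sup>2)"
    by (simp add: power2_eq_square)
  also have "\<dots> = m2 * cnj m2 * m1"
    by (simp add: u)
  finally have "- cnj u * (m2 * cnj u) = m1"
    by (simp only: mm) simp
  moreover have "u * (m2 * cnj u) = (u * cnj u) * m2"
    by simp
  then have "u * (m2 * cnj u) = m2"
    by (simp only: uu) simp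
  ultimately show "phases_to_midpoints (midpoints_to_phases x) = x"
    unfolding p by (simp add: phases_to_midpoints_def x)
qed

lemma arc_elem:
  assumes "x \<in> arc_domain"
  shows "arc_elem x \<in> fuchs_isom" and "arc_params (arc_elem x) = x"
  using polar_coeff_fuchs_elem[OF midpoints_to_phases(1)[OF assms]] midpoints_to_phases(2)[OF assms]
  by (simp_all add: arc_elem_def)

lemma phases_to_midpoints_in_domain: "x \<in> arc_domain \<Longrightarrow> phases_to_midpoints x \<in> arc_domain"
  by (auto simp: phases_to_midpoints_def arc_domain_def norm_mult)

text \<open>The branch of the square root in \<open>midpoints_to_phases\<close> may change the sign of both phases,
  which does not affect the element.\<close>

lemma arc_elem_phases_to_midpoints:
  assumes "x \<in> arc_domain"
  shows "arc_elem (phases_to_midpoints x) = (\<lambda>(a, c). fuchs_elem a c) (polar_coeff x)"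
  using arc_elem[OF phases_to_midpoints_in_domain[OF assms]] polar_coeff_fuchs_elem[OF assms]
  by (intro inj_onD[OF inj_on_arc_params]) simp_all

lemma inv_fuchs_isom:
  assumes "f \<in> fuchs_isom" and p: "arc_params f = (m1, m2, l)"
  shows "inv\<^bsub>PSL2C\<^esub> f \<in> fuchs_isom" and "arc_params (inv\<^bsub>PSL2C\<^esub> f) = (m2, m1, l)"
proof -
  obtain a c where f: "f = fuchs_elem a c" "(a, c) \<in> coeffs" "c \<noteq> 0"
    using assms(1) by (rule fuchs_isomE)
  have c': "(cnj a, - c) \<in> coeffs" using f by (simp add: coeffs_iff)
  show "inv\<^bsub>PSL2C\<^esub> f \<in> fuchs_isom"
    using f c' by (simp add: inv_fuchs_elem fuchs_isom_iff)
  have "sgn (cnj a) = cnj (sgn a)"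
    by (simp add: sgn_eq)
  then show "arc_params (inv\<^bsub>PSL2C\<^esub> f) = (m2, m1, l)"
    using p f c'
    by (auto simp: inv_fuchs_elem arc_params_fuchs_elem phases_to_midpoints_def coeff_polar_def sgn_minus)
qed

text \<open>The fraction is the square of the trace \<open>2 * Re a\<close>, written in terms of the arcs. The square
  removes the sign ambiguity of the trace of a coset.\<close>

definition generic_params :: "(complex \<times> complex \<times> real) set" where
  "generic_params = {(m1, m2, l) \<in> arc_domain.
     complex_of_real (2 * (1 - Re (m2 * cnj m1)) / (sin (l / 2))\<^sup>2) \<notin> (\<lambda>t. t\<^sup>2) ` torsion_traces}"

lemma infinite_cyclic_generic:
  assumes "f \<in> fuchs_isom" and gen: "arc_params f \<in> generic_params"
  shows "infinite (cyclic f)"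
proof
  assume fin: "finite (cyclic f)"
  obtain a c where f: "f = fuchs_elem a c" "(a, c) \<in> coeffs" "c \<noteq> 0"
    using assms(1) by (rule fuchs_isomE)
  obtain m1 m2 l where p: "arc_params (fuchs_elem a c) = (m1, m2, l)"
    by (metis prod_cases3)
  note ph = phases_from_midpoints[OF f(2,3) p]
  have a: "a \<noteq> 0" using cmod_coeffs(1)[OF f(2)] by auto
  have "(Re (sgn a))\<^sup>2 + (Im (sgn a))\<^sup>2 = 1"
    using a cmod_power2[of "sgn a"] by (simp only: norm_sgn) simp
  moreover have "Re (m2 * cnj m1) = - Re ((sgn a)\<^sup>2)"
    using ph(1) by simp
  ultimately have "1 - Re (m2 * cnj m1) = 2 * (Re (sgn a))\<^sup>2"
    by (simp add: power2_eq_square)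
  moreover have "Re (sgn a) = Re a / cmod a"
    by simp
  ultimately have "2 * (1 - Re (m2 * cnj m1)) / (sin (l / 2))\<^sup>2 = (2 * Re a)\<^sup>2"
    using a ph(3) by (simp add: power_divide power_mult_distrib)
  then have "complex_of_real (2 * (1 - Re (m2 * cnj m1)) / (sin (l / 2))\<^sup>2)
      = (complex_of_real (2 * Re a))\<^sup>2"
    by (simp only: of_real_power)
  moreover have "complex_of_real (2 * Re a) \<in> torsion_traces"
    using trace_finite_order[OF f(2,3)] fin f(1) by simp
  ultimately have "(m1, m2, l) \<notin> generic_params"
    unfolding generic_params_def mem_Collect_eq prod.case by blast
  then show False
    using gen f(1) p by simp
qed

section \<open>Uniform phases and uniform midpoints\<close>

text \<open>The part of the shifted interval beyond \<open>2 * pi\<close> is moved back by one period.\<close>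

lemma nn_integral_periodic:
  fixes g :: "real \<Rightarrow> ennreal"
  assumes [measurable]: "g \<in> borel_measurable borel" and per: "\<And>x. g (x + 2 * pi) = g x"
    and t: "0 \<le> t" "t < 2 * pi"
  shows "(\<integral>\<^sup>+x. g (x + t) * indicator {0..<2 * pi} x \<partial>lborel) =
    (\<integral>\<^sup>+x. g x * indicator {0..<2 * pi} x \<partial>lborel)"
proof -
  have "(\<integral>\<^sup>+x. g (x + t) * indicator {0..<2 * pi} x \<partial>lborel) =
      (\<integral>\<^sup>+x. g x * indicator {t..<2 * pi + t} x \<partial>lborel)"
    by (subst (2) nn_integral_real_affine[where c = 1 and t = t])
      (auto intro!: nn_integral_cong simp: indicator_def add.commute)
  also have "\<dots> = (\<integral>\<^sup>+x. g x * indicator {t..<2 * pi} x \<partial>lborel) +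
      (\<integral>\<^sup>+x. g x * indicator {2 * pi..<2 * pi + t} x \<partial>lborel)"
    using t by (subst nn_integral_add[symmetric])
      (auto intro!: nn_integral_cong simp: indicator_def)
  also have "(\<integral>\<^sup>+x. g x * indicator {2 * pi..<2 * pi + t} x \<partial>lborel) =
      (\<integral>\<^sup>+x. g x * indicator {0..<t} x \<partial>lborel)"
    by (subst nn_integral_real_affine[where c = 1 and t = "2 * pi"])
      (auto intro!: nn_integral_cong simp: indicator_def per[unfolded add.commute[of _ "2 * pi"]])
  also have "(\<integral>\<^sup>+x. g x * indicator {t..<2 * pi} x \<partial>lborel) + \<dots> =
      (\<integral>\<^sup>+x. g x * indicator {0..<2 * pi} x \<partial>lborel)"
    using t by (subst nn_integral_add[symmetric])
      (auto intro!: nn_integral_cong simp: indicator_def)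
  finally show ?thesis .
qed

lemma sets_circle_uniform [measurable_cong, simp]: "sets circle_uniform = sets borel"
  by (simp add: circle_uniform_def)

lemma space_circle_uniform [simp]: "space circle_uniform = UNIV"
  by (simp add: circle_uniform_def)

lemma measurable_cis [measurable]: "cis \<in> borel_measurable borel"
  by (intro borel_measurable_continuous_onI continuous_intros)

lemma prob_space_circle_uniform: "prob_space circle_uniform"
  unfolding circle_uniform_def
  by (intro prob_space.prob_space_distr prob_space_uniform_measure) auto

lemma AE_circle_uniform: "AE z in circle_uniform. cmod z = 1"
  unfolding circle_uniform_def by (subst AE_distr_iff) auto

lemma nn_integral_circle_uniform:
  assumes [measurable]: "h \<in> borel_measurable borel"
  shows "(\<integral>\<^sup>+z. h z \<partial>circle_uniform) =
    (\<integral>\<^sup>+x. h (cis x) * indicator {0..<2 * pi} x \<partial>lborel) / ennreal (2 * pi)"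
  unfolding circle_uniform_def by (simp add: nn_integral_distr nn_integral_uniform_measure)

lemma circle_uniform_rotate:
  assumes w: "cmod w = 1" and [measurable]: "h \<in> borel_measurable borel"
  shows "(\<integral>\<^sup>+z. h (w * z) \<partial>circle_uniform) = (\<integral>\<^sup>+z. h z \<partial>circle_uniform)"
proof -
  obtain t where t: "0 \<le> t" "t < 2 * pi" "w = cis t"
    using Arg2pi_ge_0[of w] Arg2pi_lt_2pi[of w] Arg2pi_eq[of w] w by (auto simp: cis_conv_exp)
  have "(\<integral>\<^sup>+x. h (cis (x + t)) * indicator {0..<2 * pi} x \<partial>lborel) =
      (\<integral>\<^sup>+x. h (cis x) * indicator {0..<2 * pi} x \<partial>lborel)"
    using nn_integral_periodic[of "\<lambda>x. h (cis x)" t] t by (simp flip: cis_mult)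
  then show ?thesis
    by (simp add: nn_integral_circle_uniform t(3) cis_mult add.commute)
qed

lemma circle_uniform_square:
  assumes [measurable]: "h \<in> borel_measurable borel"
  shows "(\<integral>\<^sup>+z. h (z\<^sup>2) \<partial>circle_uniform) = (\<integral>\<^sup>+z. h z \<partial>circle_uniform)"
proof -
  define J where "J g = (\<integral>\<^sup>+x. g x * indicator {0..<2 * pi} x \<partial>lborel)" for g :: "real \<Rightarrow> ennreal"
  have "2 * J (\<lambda>x. h (cis (2 * x))) =
      (\<integral>\<^sup>+x. h (cis x) * indicator {0..<4 * pi} x \<partial>lborel)"
    unfolding J_def by (subst (2) nn_integral_real_affine[where c = 2 and t = 0])
      (auto intro!: arg_cong[where f = "(*) 2"] nn_integral_cong simp: indicator_def)
  also have "\<dots> = J (\<lambda>x. h (cis x)) +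
      (\<integral>\<^sup>+x. h (cis x) * indicator {2 * pi..<4 * pi} x \<partial>lborel)"
    unfolding J_def
    by (subst nn_integral_add[symmetric]) (auto intro!: nn_integral_cong simp: indicator_def)
  also have "(\<integral>\<^sup>+x. h (cis x) * indicator {2 * pi..<4 * pi} x \<partial>lborel) = J (\<lambda>x. h (cis x))"
    unfolding J_def by (subst nn_integral_real_affine[where c = 1 and t = "2 * pi"])
      (auto intro!: nn_integral_cong simp: indicator_def simp flip: cis_mult)
  finally have "2 * J (\<lambda>x. h (cis (2 * x))) = 2 * J (\<lambda>x. h (cis x))"
    by (simp only: mult_2)
  then have "J (\<lambda>x. h (cis (2 * x))) = J (\<lambda>x. h (cis x))"
    by (simp add: ennreal_mult_cancel_left)
  then show ?thesis
    by (simp add: nn_integral_circle_uniform power2_eq_square cis_mult J_def)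
qed

text \<open>Two independent uniform phases give two independent uniform midpoints. For fixed \<open>u\<close> the point
  \<open>w = - cnj u * v\<close> is uniform because \<open>v\<close> is, and \<open>u * v = - u\<^sup>2 * w\<close>. After exchanging the order
  of integration, for fixed \<open>w\<close> the point \<open>- u\<^sup>2 * w\<close> is uniform because \<open>u\<close> is, by the invariance
  of the uniform law under squaring and rotation.\<close>

lemma nn_integral_phases_to_midpoints:
  assumes h [measurable]: "h \<in> borel_measurable (borel \<Otimes>\<^sub>M borel)"
  shows "(\<integral>\<^sup>+u. \<integral>\<^sup>+v. h (- cnj u * v, u * v) \<partial>circle_uniform \<partial>circle_uniform) =
    (\<integral>\<^sup>+u. \<integral>\<^sup>+v. h (u, v) \<partial>circle_uniform \<partial>circle_uniform)"
proof -
  interpret C: prob_space circle_uniform by (rule prob_space_circle_uniform)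
  interpret CC: pair_sigma_finite circle_uniform circle_uniform ..
  have cnj_m [measurable]: "cnj \<in> borel_measurable borel"
    by (intro borel_measurable_continuous_onI continuous_intros)
  have h' [measurable]: "h \<in> borel_measurable (circle_uniform \<Otimes>\<^sub>M circle_uniform)"
    using h by (simp cong: measurable_cong_sets sets_pair_measure_cong)
  have inner1: "(\<integral>\<^sup>+v. h (- cnj u * v, u * v) \<partial>circle_uniform) =
      (\<integral>\<^sup>+w. h (w, - u\<^sup>2 * w) \<partial>circle_uniform)" if u: "cmod u = 1" for u
  proof -
    have uu: "u * cnj u = 1"
      using u by (simp add: complex_norm_square[symmetric])
    have "- (u\<^sup>2) * (- cnj u * v) = (u * cnj u) * (u * v)" for v
      by (simp add: power2_eq_square mult_ac)
    then have *: "- (u\<^sup>2) * (- cnj u * v) = u * v" for v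
      by (simp only: uu) simp
    have "(\<integral>\<^sup>+v. h (- cnj u * v, - (u\<^sup>2) * (- cnj u * v)) \<partial>circle_uniform) =
        (\<integral>\<^sup>+w. h (w, - (u\<^sup>2) * w) \<partial>circle_uniform)"
      using u by (intro circle_uniform_rotate[where h = "\<lambda>w. h (w, - (u\<^sup>2) * w)"]) auto
    then show ?thesis
      by (simp only: *)
  qed
  have inner2: "(\<integral>\<^sup>+u. h (w, - u\<^sup>2 * w) \<partial>circle_uniform) = (\<integral>\<^sup>+v. h (w, v) \<partial>circle_uniform)"
    if w: "cmod w = 1" for w
  proof -
    have "(\<integral>\<^sup>+u. h (w, - w * u\<^sup>2) \<partial>circle_uniform) = (\<integral>\<^sup>+z. h (w, - w * z) \<partial>circle_uniform)"
      by (rule circle_uniform_square[where h = "\<lambda>z. h (w, - w * z)"]) measurable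
    also have "\<dots> = (\<integral>\<^sup>+z. h (w, z) \<partial>circle_uniform)"
      using w by (intro circle_uniform_rotate[where h = "\<lambda>z. h (w, z)"]) auto
    finally show ?thesis
      by (simp add: mult.commute)
  qed
  have "(\<integral>\<^sup>+u. \<integral>\<^sup>+v. h (- cnj u * v, u * v) \<partial>circle_uniform \<partial>circle_uniform) =
      (\<integral>\<^sup>+u. \<integral>\<^sup>+w. h (w, - u\<^sup>2 * w) \<partial>circle_uniform \<partial>circle_uniform)"
    using AE_circle_uniform inner1 by (intro nn_integral_cong_AE) auto
  also have "\<dots> = (\<integral>\<^sup>+w. \<integral>\<^sup>+u. h (w, - u\<^sup>2 * w) \<partial>circle_uniform \<partial>circle_uniform)"
    by (rule CC.Fubini') measurable
  also have "\<dots> = (\<integral>\<^sup>+w. \<integral>\<^sup>+v. h (w, v) \<partial>circle_uniform \<partial>circle_uniform)"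
    using AE_circle_uniform inner2 by (intro nn_integral_cong_AE) auto
  finally show ?thesis .
qed

abbreviation data_algebra :: "(complex \<times> complex \<times> real) measure" where
  "data_algebra \<equiv> borel \<Otimes>\<^sub>M borel \<Otimes>\<^sub>M borel"

abbreviation length_uniform :: "real measure" where
  "length_uniform \<equiv> uniform_measure lborel {0..pi}"

lemma prob_space_length_uniform: "prob_space length_uniform"
  by (intro prob_space_uniform_measure) auto

lemma sets_uniform_data [measurable_cong, simp]: "sets uniform_data = sets data_algebra"
  unfolding uniform_data_def by (intro sets_pair_measure_cong) auto

lemma space_uniform_data [simp]: "space uniform_data = UNIV"
  by (simp add: uniform_data_def space_pair_measure)

lemma nn_integral_uniform_data:
  assumes h: "h \<in> borel_measurable data_algebra"
  shows "(\<integral>\<^sup>+x. h x \<partial>uniform_data) =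
    (\<integral>\<^sup>+u. \<integral>\<^sup>+v. \<integral>\<^sup>+l. h (u, v, l) \<partial>length_uniform \<partial>circle_uniform \<partial>circle_uniform)"
proof -
  interpret C: prob_space circle_uniform by (rule prob_space_circle_uniform)
  interpret L: prob_space length_uniform by (rule prob_space_length_uniform)
  interpret CL: pair_sigma_finite circle_uniform length_uniform ..
  interpret CCL: pair_sigma_finite circle_uniform "circle_uniform \<Otimes>\<^sub>M length_uniform" ..
  have [measurable]: "h \<in> borel_measurable (circle_uniform \<Otimes>\<^sub>M circle_uniform \<Otimes>\<^sub>M length_uniform)"
    using h sets_uniform_data by (simp add: uniform_data_def cong: measurable_cong_sets)
  have "(\<integral>\<^sup>+x. h x \<partial>uniform_data) =
      (\<integral>\<^sup>+u. \<integral>\<^sup>+y. h (u, y) \<partial>(circle_uniform \<Otimes>\<^sub>M length_uniform) \<partial>circle_uniform)"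
    unfolding uniform_data_def by (subst CL.P.nn_integral_fst[symmetric]) auto
  also have "\<dots> = (\<integral>\<^sup>+u. \<integral>\<^sup>+v. \<integral>\<^sup>+l. h (u, v, l) \<partial>length_uniform \<partial>circle_uniform \<partial>circle_uniform)"
    by (intro nn_integral_cong, subst L.nn_integral_fst[symmetric]) auto
  finally show ?thesis .
qed

lemma measurable_phases_to_midpoints [measurable]:
  "phases_to_midpoints \<in> measurable data_algebra data_algebra"
proof -
  have [measurable]: "cnj \<in> borel_measurable borel"
    by (intro borel_measurable_continuous_onI continuous_intros)
  show ?thesis
    unfolding phases_to_midpoints_def by measurable
qed

lemma distr_phases_to_midpoints:
  "distr uniform_data data_algebra phases_to_midpoints = uniform_data"
proof (rule measure_eqI)
  interpret C: prob_space circle_uniform by (rule prob_space_circle_uniform)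
  interpret L: prob_space length_uniform by (rule prob_space_length_uniform)
  fix S assume "S \<in> sets (distr uniform_data data_algebra phases_to_midpoints)"
  then have S [measurable]: "S \<in> sets data_algebra" by simp
  define h where "h = (\<lambda>(u, v). \<integral>\<^sup>+l. indicator S (u, v, l) \<partial>length_uniform)"
  have h [measurable]: "h \<in> borel_measurable (borel \<Otimes>\<^sub>M borel)"
    unfolding h_def by measurable
  have "emeasure (distr uniform_data data_algebra phases_to_midpoints) S =
      (\<integral>\<^sup>+x. indicator S (phases_to_midpoints x) \<partial>uniform_data)"
    by (subst nn_integral_distr[symmetric, of _ _ data_algebra]) auto
  also have "\<dots> = (\<integral>\<^sup>+u. \<integral>\<^sup>+v. h (- cnj u * v, u * v) \<partial>circle_uniform \<partial>circle_uniform)"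
    by (subst nn_integral_uniform_data, measurable) (simp add: phases_to_midpoints_def h_def)
  also have "\<dots> = (\<integral>\<^sup>+u. \<integral>\<^sup>+v. h (u, v) \<partial>circle_uniform \<partial>circle_uniform)"
    by (rule nn_integral_phases_to_midpoints) fact
  also have "\<dots> = (\<integral>\<^sup>+x. indicator S x \<partial>uniform_data)"
    by (subst nn_integral_uniform_data, measurable) (simp add: h_def)
  finally show "emeasure (distr uniform_data data_algebra phases_to_midpoints) S = emeasure uniform_data S"
    by simp
qed simp

lemma AE_uniform_data:
  assumes "Measurable.pred data_algebra P"
    and "AE u in circle_uniform. AE v in circle_uniform. AE l in length_uniform. P (u, v, l)"
  shows "AE x in uniform_data. P x"
proof -
  interpret C: prob_space circle_uniform by (rule prob_space_circle_uniform)
  interpret L: prob_space length_uniform by (rule prob_space_length_uniform)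
  interpret CL: pair_sigma_finite circle_uniform length_uniform ..
  interpret CCL: pair_sigma_finite circle_uniform "circle_uniform \<Otimes>\<^sub>M length_uniform" ..
  have [measurable]: "Measurable.pred (circle_uniform \<Otimes>\<^sub>M circle_uniform \<Otimes>\<^sub>M length_uniform) P"
    using assms(1) sets_uniform_data by (simp add: uniform_data_def cong: measurable_cong_sets)
  have "AE u in circle_uniform. AE y in circle_uniform \<Otimes>\<^sub>M length_uniform. P (u, y)"
    using assms(2)
  proof eventually_elim
    case (elim u)
    have "{y \<in> space (circle_uniform \<Otimes>\<^sub>M length_uniform). P (u, y)}
        \<in> sets (circle_uniform \<Otimes>\<^sub>M length_uniform)"
      by measurable
    then show ?case
      using elim by (rule CL.AE_pair_measure)
  qed
  moreover have "{x \<in> space (circle_uniform \<Otimes>\<^sub>M circle_uniform \<Otimes>\<^sub>M length_uniform). P x}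
      \<in> sets (circle_uniform \<Otimes>\<^sub>M circle_uniform \<Otimes>\<^sub>M length_uniform)"
    by measurable
  ultimately show ?thesis
    unfolding uniform_data_def by (intro CCL.AE_pair_measure)
qed

section \<open>Random elements and random arcs\<close>

lemma fuchs_group_cosets:
  assumes "f \<in> fuchs_group" "A \<in> f" shows "f = {A, - A}"
  using assms by (auto simp: fuchs_group_def fuchs_elem_eq)

text \<open>The measurable sets of \<open>fuchs_space\<close> are described through their unions, so the set of all
  matrices that represent an element of the group has to be a Borel set; it is even closed.\<close>

lemma Union_fuchs_group_borel: "\<Union>fuchs_group \<in> sets borel"
proof -
  have "\<Union>fuchs_group = {A. A$2$1 = cnj (A$1$2) \<and> A$2$2 = cnj (A$1$1) \<and>
      (cmod (A$1$1))\<^sup>2 - (cmod (A$1$2))\<^sup>2 = 1}" (is "_ = ?S")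
  proof (intro subset_antisym subsetI)
    fix A assume "A \<in> \<Union>fuchs_group"
    then show "A \<in> ?S"
      by (auto simp: fuchs_group_def fuchs_elem_eq coeffs_def)
  next
    fix A assume A: "A \<in> ?S"
    then have "A = fuchs_mat (A$1$1) (A$1$2)" "(A$1$1, A$1$2) \<in> coeffs"
      by (simp_all add: matrix_2_eq_iff coeffs_def)
    then show "A \<in> \<Union>fuchs_group"
      unfolding fuchs_group_def fuchs_elem_eq by blast
  qed
  moreover have "closed ?S"
    by (intro closed_Collect_conj closed_Collect_eq continuous_intros)
  ultimately show ?thesis by simp
qed

text \<open>Complements survive the passage to unions because distinct cosets are disjoint. Hence the
  generators of \<open>fuchs_space\<close> are already all of its measurable sets.\<close>

lemma sigma_algebra_fuchs_space:
  "sigma_algebra fuchs_group {B. B \<subseteq> fuchs_group \<and> \<Union>B \<in> sets borel}"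
  unfolding sigma_algebra_iff2
proof (intro conjI ballI allI impI)
  fix B assume B: "B \<in> {B. B \<subseteq> fuchs_group \<and> \<Union>B \<in> sets borel}"
  have "\<Union>(fuchs_group - B) = \<Union>fuchs_group - \<Union>B"
    using B by (blast dest: fuchs_group_cosets)
  then show "fuchs_group - B \<in> {B. B \<subseteq> fuchs_group \<and> \<Union>B \<in> sets borel}"
    using B Union_fuchs_group_borel by auto
next
  fix B :: "nat \<Rightarrow> (complex^2^2) set set"
  assume B: "range B \<subseteq> {B. B \<subseteq> fuchs_group \<and> \<Union>B \<in> sets borel}"
  have "\<Union>(\<Union>(range B)) = (\<Union>i. \<Union>(B i))"
    by blast
  also have "\<dots> \<in> sets borel"
    using B by (intro sets.countable_UN) auto
  finally show "\<Union>(range B) \<in> {B. B \<subseteq> fuchs_group \<and> \<Union>B \<in> sets borel}"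
    using B by auto
qed auto

lemma space_fuchs_space [simp]: "space fuchs_space = fuchs_group"
  unfolding fuchs_space_def by (intro space_measure_of) auto

lemma sets_fuchs_space: "sets fuchs_space = {B. B \<subseteq> fuchs_group \<and> \<Union>B \<in> sets borel}"
  unfolding fuchs_space_def by (rule sigma_algebra.sets_measure_of_eq[OF sigma_algebra_fuchs_space])

text \<open>The universal property of the quotient: a function of cosets is measurable if it is induced by
  a measurable function of matrices.\<close>

lemma measurable_from_fuchs_space:
  assumes g: "g \<in> measurable borel N" and h: "\<And>f A. f \<in> fuchs_group \<Longrightarrow> A \<in> f \<Longrightarrow> h f = g A"
  shows "h \<in> measurable fuchs_space N"
proof (rule measurableI)
  fix f assume "f \<in> space fuchs_space"
  then have f: "f \<in> fuchs_group" by simp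
  then obtain A where "A \<in> f"
    by (auto simp: fuchs_group_def fuchs_elem_eq)
  then show "h f \<in> space N"
    using h[OF f] measurable_space[OF g] by simp
next
  fix V assume V: "V \<in> sets N"
  have "\<Union>(h -` V \<inter> fuchs_group) = \<Union>fuchs_group \<inter> (g -` V \<inter> space borel)"
    using h by auto
  also have "\<dots> \<in> sets borel"
    by (intro sets.Int Union_fuchs_group_borel measurable_sets[OF g V])
  finally show "h -` V \<inter> space fuchs_space \<in> sets fuchs_space"
    by (simp add: sets_fuchs_space)
qed

lemma borel_measurable_arcsin [measurable]: "arcsin \<in> borel_measurable borel"
proof -
  \<comment> \<open>outside \<open>[-1, 1]\<close> there is no preimage, and \<open>arcsin\<close> takes a constant value\<close>
  have "arcsin y = (THE x. False)" if "y \<notin> {-1..1}" for y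
  proof -
    have "sin x \<noteq> y" for x using that by auto
    then show ?thesis by (simp add: arcsin_def)
  qed
  then have "arcsin = (\<lambda>y. if y \<in> {-1..1} then arcsin y else (THE x. False))"
    by auto
  moreover have "(\<lambda>y. if y \<in> {-1..1} then arcsin y else (THE x. False)) \<in> borel_measurable borel"
    by (intro borel_measurable_continuous_on_if continuous_on_arcsin') auto
  ultimately show ?thesis by simp
qed

lemma borel_measurable_csqrt [measurable]: "csqrt \<in> borel_measurable borel"
  by (subst borel_measurable_complex_iff) simp

lemma measurable_coeff_polar [measurable]: "coeff_polar \<in> measurable borel data_algebra"
  unfolding coeff_polar_def borel_prod[symmetric] by measurable

lemma measurable_arc_params [measurable]: "arc_params \<in> measurable fuchs_space data_algebra"
proof (rule measurable_from_fuchs_space)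
  have "(\<lambda>A::complex^2^2. (A$1$1, A$1$2)) \<in> borel_measurable borel"
    by (intro borel_measurable_continuous_onI continuous_intros)
  then show "(\<lambda>A::complex^2^2. phases_to_midpoints (coeff_polar (A$1$1, A$1$2))) \<in> measurable borel data_algebra"
    by (intro measurable_compose[OF _ measurable_phases_to_midpoints]
        measurable_compose[OF _ measurable_coeff_polar])
qed (rule arc_params_eqI)

lemma pred_arc_domain [measurable]: "Measurable.pred data_algebra (\<lambda>x. x \<in> arc_domain)"
  unfolding arc_domain_def mem_Collect_eq by measurable

lemma measurable_polar_coeff [measurable]:
  "polar_coeff \<in> measurable data_algebra (restrict_space borel coeffs)"
proof (rule measurable_restrict_space2)
  have *: "polar_coeff = (\<lambda>x. if x \<in> arc_domain
     then (fst x / of_real (sin (snd (snd x) / 2)),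
       fst (snd x) * of_real (cos (snd (snd x) / 2) / sin (snd (snd x) / 2))) else (1, 0))"
    by (auto simp: polar_coeff_def cot_def)
  show "polar_coeff \<in> borel_measurable data_algebra"
    unfolding * borel_prod[symmetric] by measurable
qed (simp add: polar_coeff_in_coeffs)

lemma measurable_midpoints_to_phases [measurable]:
  "midpoints_to_phases \<in> measurable data_algebra data_algebra"
proof -
  have [measurable]: "cnj \<in> borel_measurable borel"
    by (intro borel_measurable_continuous_onI continuous_intros)
  show ?thesis
    unfolding midpoints_to_phases_def Let_def by measurable
qed

lemma measurable_fuchs_elem [measurable]:
  "(\<lambda>(a, c). fuchs_elem a c) \<in> measurable (restrict_space borel coeffs) fuchs_space"
proof (rule measurableI)
  fix x assume "x \<in> space (restrict_space borel coeffs)"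
  then show "(\<lambda>(a, c). fuchs_elem a c) x \<in> space fuchs_space"
    by (cases x) (auto simp: space_restrict_space fuchs_group_def)
next
  let ?m = "\<lambda>(a, c). fuchs_mat a c"
  fix B assume "B \<in> sets fuchs_space"
  then have B: "B \<subseteq> fuchs_group" "\<Union>B \<in> sets borel"
    by (auto simp: sets_fuchs_space)
  have "linear ?m"
    by (rule linearI) (auto simp: matrix_2_eq_iff)
  then have m: "?m \<in> borel_measurable borel"
    by (intro borel_measurable_continuous_onI linear_continuous_on)
      (simp add: linear_conv_bounded_linear)
  have "fuchs_elem a c \<in> B \<longleftrightarrow> fuchs_mat a c \<in> \<Union>B" if ac: "(a, c) \<in> coeffs" for a c
  proof
    assume "fuchs_mat a c \<in> \<Union>B"
    then obtain g where g: "g \<in> B" "fuchs_mat a c \<in> g" by blast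
    then have "g = fuchs_elem a c"
      unfolding fuchs_elem_eq using B(1) by (intro fuchs_group_cosets) auto
    with g show "fuchs_elem a c \<in> B" by simp
  next
    assume "fuchs_elem a c \<in> B"
    moreover have "fuchs_mat a c \<in> fuchs_elem a c" by (simp add: fuchs_elem_eq)
    ultimately show "fuchs_mat a c \<in> \<Union>B" by (rule UnionI)
  qed
  then have "x \<in> coeffs \<and> (\<lambda>(a, c). fuchs_elem a c) x \<in> B \<longleftrightarrow> x \<in> coeffs \<and> ?m x \<in> \<Union>B" for x
    by (cases x) (simp cong: conj_cong del: Union_iff)
  then have "(\<lambda>(a, c). fuchs_elem a c) -` B \<inter> coeffs = (?m -` \<Union>B) \<inter> coeffs"
    by (simp only: set_eq_iff Int_iff vimage_eq conj_commute simp_thms)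
  moreover have "?m -` \<Union>B \<in> sets borel"
    using measurable_sets[OF m B(2)] by simp
  ultimately show "(\<lambda>(a, c). fuchs_elem a c) -` B \<inter> space (restrict_space borel coeffs)
      \<in> sets (restrict_space borel coeffs)"
    by (auto simp: space_restrict_space sets_restrict_space)
qed

lemma measurable_arc_elem [measurable]: "arc_elem \<in> measurable data_algebra fuchs_space"
  unfolding arc_elem_def by measurable

lemma AE_arc_domain: "AE x in uniform_data. x \<in> arc_domain"
proof (rule AE_uniform_data)
  have L: "AE l in length_uniform. 0 < l \<and> l < pi"
    using AE_lborel_singleton[of 0] AE_lborel_singleton[of pi]
    by (intro AE_uniform_measureI) auto
  show "AE u in circle_uniform. AE v in circle_uniform. AE l in length_uniform.
      (u, v, l) \<in> arc_domain"
    using AE_circle_uniform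
  proof eventually_elim
    case u: (elim u)
    show ?case using AE_circle_uniform
    proof eventually_elim
      case v: (elim v)
      show ?case using L by eventually_elim (simp add: u v arc_domain_def)
    qed
  qed
qed measurable

lemma AE_circle_uniform_singleton:
  assumes u: "cmod u = 1" shows "AE v in circle_uniform. v \<noteq> u"
proof -
  have "AE x in lborel. x \<in> {0..<2 * pi} \<longrightarrow> cis x \<noteq> u"
    using AE_lborel_singleton[of "Arg2pi u"]
  proof eventually_elim
    case (elim x)
    then show ?case
      using Arg2pi_unique[of 1 x u] by (auto simp: cis_conv_exp)
  qed
  then show ?thesis
    unfolding circle_uniform_def
    by (subst AE_distr_iff) (auto intro!: AE_uniform_measureI)
qed

text \<open>For each of the countably many forbidden traces and for fixed distinct midpoints, the equation
  for \<open>sin (l / 2)\<close> has at most one solution \<open>l\<close>. Equal midpoints have probability 0; they belong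
  to elements of trace 0, which are involutions for every \<open>l\<close>.\<close>

lemma AE_generic_params: "AE x in uniform_data. x \<in> generic_params"
proof -
  let ?g = "\<lambda>(m1, m2, l). complex_of_real (2 * (1 - Re (m2 * cnj m1)) / (sin (l / 2))\<^sup>2)"
  have [measurable]: "cnj \<in> borel_measurable borel"
    by (intro borel_measurable_continuous_onI continuous_intros)
  have "AE x in uniform_data. ?g x \<noteq> t\<^sup>2" for t :: complex
  proof (rule AE_uniform_data)
    show "AE u in circle_uniform. AE v in circle_uniform. AE l in length_uniform.
        ?g (u, v, l) \<noteq> t\<^sup>2"
      using AE_circle_uniform
    proof eventually_elim
      case u: (elim u)
      show ?case
        using AE_circle_uniform AE_circle_uniform_singleton[OF u]
      proof eventually_elim
        case v: (elim v)
        define K where "K = 2 * (1 - Re (v * cnj u))"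
        have K: "K \<noteq> 0"
          using Re_mult_cnj_le_1(2)[OF v(1) u] v(2) unfolding K_def by auto
        have one: "l = 2 * arcsin (sqrt (K / Re (t\<^sup>2)))"
          if l: "0 < l" "l \<le> pi" "complex_of_real (K / (sin (l / 2))\<^sup>2) = t\<^sup>2" for l
        proof -
          have s: "sin (l / 2) > 0" using l by (intro sin_gt_zero) auto
          have "Re (t\<^sup>2) = K / (sin (l / 2))\<^sup>2"
            unfolding l(3)[symmetric] by simp
          then have "K / Re (t\<^sup>2) = (sin (l / 2))\<^sup>2"
            using K s by simp
          then have "sqrt (K / Re (t\<^sup>2)) = sin (l / 2)"
            using s by simp
          moreover have "arcsin (sin (l / 2)) = l / 2"
            using l by (intro arcsin_sin) auto
          ultimately show ?thesis by simp
        qed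
        have "AE l in lborel. l \<in> {0..pi} \<longrightarrow> complex_of_real (K / (sin (l / 2))\<^sup>2) \<noteq> t\<^sup>2"
          using AE_lborel_singleton[of 0] AE_lborel_singleton[of "2 * arcsin (sqrt (K / Re (t\<^sup>2)))"]
        proof eventually_elim
          case (elim l)
          then show ?case using one[of l] by force
        qed
        then show ?case
          unfolding K_def prod.case by (intro AE_uniform_measureI) auto
      qed
    qed
  qed measurable
  then have "AE x in uniform_data. \<forall>t\<in>torsion_traces. ?g x \<noteq> t\<^sup>2"
    by (simp add: AE_ball_countable countable_torsion_traces)
  then show ?thesis
    using AE_arc_domain
    by eventually_elim (force simp: generic_params_def simp del: times_complex.sel)
qed

text \<open>The law of the arcs of a random element is the image of the uniform law of the phases and the
  length under \<open>phases_to_midpoints\<close>, which preserves it.\<close>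

lemma distr_arc_params:
  assumes "random_element M f"
  shows "distr M data_algebra (\<lambda>w. arc_params (f w)) = uniform_data"
proof -
  have f [measurable]: "f \<in> measurable M fuchs_space"
    using assms by (simp add: random_element_def)
  obtain N where N: "random_coeffs N"
    and law: "distr M fuchs_space f = distr N fuchs_space (\<lambda>(a, c). fuchs_elem a c)"
    using assms by (auto simp: random_element_def)
  have sN [measurable_cong]: "sets N = sets (restrict_space borel coeffs)"
    and spN: "space N = coeffs"
    and polar: "distr N data_algebra coeff_polar = uniform_data"
    using N by (simp_all add: random_coeffs_def coeff_polar_def)
  have [measurable]: "coeff_polar \<in> measurable N data_algebra"
    by (subst measurable_cong_sets[OF sN refl]) (rule measurable_restrict_space1, measurable)
  have "distr M data_algebra (\<lambda>w. arc_params (f w)) = distr (distr M fuchs_space f) data_algebra arc_params"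
    by (subst distr_distr) (auto simp: comp_def)
  also have "\<dots> = distr N data_algebra (\<lambda>x. arc_params ((\<lambda>(a, c). fuchs_elem a c) x))"
    unfolding law by (subst distr_distr) (auto simp: comp_def)
  also have "\<dots> = distr N data_algebra (\<lambda>x. phases_to_midpoints (coeff_polar x))"
    by (intro distr_cong refl) (auto simp: spN arc_params_fuchs_elem)
  also have "\<dots> = distr (distr N data_algebra coeff_polar) data_algebra phases_to_midpoints"
    by (subst distr_distr) (auto simp: comp_def)
  finally show ?thesis
    by (simp add: polar distr_phases_to_midpoints)
qed

lemma prob_space_uniform_data: "prob_space uniform_data"
  unfolding uniform_data_def
  by (intro prob_space_pair prob_space_circle_uniform prob_space_length_uniform)

lemma random_element_arc_elem:
  assumes M: "prob_space M" and X [measurable]: "X \<in> measurable M data_algebra"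
    and law: "distr M data_algebra X = uniform_data"
  shows "random_element M (\<lambda>w. arc_elem (X w))"
proof -
  define N where "N = distr uniform_data (restrict_space borel coeffs) polar_coeff"
  have [measurable]: "coeff_polar \<in> measurable (restrict_space borel coeffs) data_algebra"
    by (rule measurable_restrict_space1) measurable
  have "distr N data_algebra coeff_polar = distr uniform_data data_algebra (\<lambda>x. coeff_polar (polar_coeff x))"
    unfolding N_def by (subst distr_distr) (auto simp: comp_def)
  also have "\<dots> = distr uniform_data uniform_data (\<lambda>x. x)"
    using AE_arc_domain by (intro distr_cong_AE refl) (auto simp: coeff_polar_polar_coeff(1))
  also have "\<dots> = uniform_data"
    by (simp add: distr_id2)
  finally have "random_coeffs N"
    unfolding random_coeffs_def coeff_polar_def[symmetric] N_def
    by (auto simp: space_restrict_space intro!: prob_space.prob_space_distr prob_space_uniform_data)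
  moreover have "distr M fuchs_space (\<lambda>w. arc_elem (X w)) = distr N fuchs_space (\<lambda>(a, c). fuchs_elem a c)"
  proof -
    \<comment> \<open>replacing uniform midpoints by the midpoints of uniform phases makes the square root in \<open>arc_elem\<close> disappear\<close>
    have "distr M fuchs_space (\<lambda>w. arc_elem (X w)) = distr (distr M data_algebra X) fuchs_space arc_elem"
      by (subst distr_distr) (auto simp: comp_def)
    also have "\<dots> = distr (distr uniform_data data_algebra phases_to_midpoints) fuchs_space arc_elem"
      by (simp add: law distr_phases_to_midpoints)
    also have "\<dots> = distr uniform_data fuchs_space (\<lambda>x. arc_elem (phases_to_midpoints x))"
      by (subst distr_distr) (auto simp: comp_def)
    also have "\<dots> = distr uniform_data fuchs_space (\<lambda>x. (\<lambda>(a, c). fuchs_elem a c) (polar_coeff x))"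
      using AE_arc_domain by (intro distr_cong_AE refl) (auto simp: arc_elem_phases_to_midpoints)
    also have "\<dots> = distr N fuchs_space (\<lambda>(a, c). fuchs_elem a c)"
      unfolding N_def by (subst distr_distr) (auto simp: comp_def)
    finally show ?thesis .
  qed
  ultimately show ?thesis
    unfolding random_element_def using M by auto
qed

section \<open>Pairs of arcs and generators up to inversion\<close>

abbreviation isom_arcs :: "(complex^2^2) set \<Rightarrow> complex set set" where
  "isom_arcs f \<equiv> {isom_arc1 f, isom_arc2 f}"

lemma isom_arcs_params:
  assumes "f \<in> fuchs_isom" and "arc_params f = (m1, m2, l)"
  shows "isom_arc1 f = circle_arc m1 l" "isom_arc2 f = circle_arc m2 l"
  using assms arc_params_in_domain[OF assms(1)] has_arcs_iff[of m1 m2 l f] by (simp_all add: has_arcs_def)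

lemma arc_pairs_iff: "P \<in> arc_pairs \<longleftrightarrow> (\<exists>f\<in>fuchs_isom. P = isom_arcs f)"
proof
  assume "P \<in> arc_pairs"
  then obtain m1 m2 l where P: "P = {circle_arc m1 l, circle_arc m2 l}" "(m1, m2, l) \<in> arc_domain"
    by (auto simp: arc_pairs_def arc_domain_def)
  then show "\<exists>f\<in>fuchs_isom. P = isom_arcs f"
    using arc_elem[OF P(2)] isom_arcs_params by metis
next
  assume "\<exists>f\<in>fuchs_isom. P = isom_arcs f"
  then obtain f where f: "f \<in> fuchs_isom" "P = isom_arcs f" by blast
  obtain m1 m2 l where p: "arc_params f = (m1, m2, l)"
    by (metis prod_cases3)
  then have "P = {circle_arc m1 l, circle_arc m2 l}" "(m1, m2, l) \<in> arc_domain"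
    using f isom_arcs_params[OF f(1) p] arc_params_in_domain[OF f(1)] by simp_all
  then show "P \<in> arc_pairs"
    by (auto simp: arc_pairs_def arc_domain_def)
qed

lemma isom_arcs_in_arc_pairs: "f \<in> fuchs_isom \<Longrightarrow> isom_arcs f \<in> arc_pairs"
  unfolding arc_pairs_iff by blast

lemma pair_elems_isom_arcs:
  assumes f: "f \<in> fuchs_isom"
  shows "pair_elems (isom_arcs f) = {f, inv\<^bsub>PSL2C\<^esub> f}"
proof -
  obtain m1 m2 l where p: "arc_params f = (m1, m2, l)"
    by (metis prod_cases3)
  have dom: "(m1, m2, l) \<in> arc_domain" "(m2, m1, l) \<in> arc_domain"
    using arc_params_in_domain[OF f] p by (auto simp: arc_domain_def)
  note inv = inv_fuchs_isom[OF f p]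
  have f_iff: "has_arcs g m1 m2 l \<longleftrightarrow> g = f" and inv_iff: "has_arcs g m2 m1 l \<longleftrightarrow> g = inv\<^bsub>PSL2C\<^esub> f" for g
    using has_arcs_iff[OF dom(1), of g] has_arcs_iff[OF dom(2), of g] f p inv
      inj_onD[OF inj_on_arc_params, of g] by metis+
  have "pair_elems (isom_arcs f) = {g. has_arcs g m1 m2 l \<or> has_arcs g m2 m1 l}"
    unfolding pair_elems_def has_arcs_def isom_arcs_params[OF f p] doubleton_eq_iff by blast
  then show ?thesis
    by (auto simp: f_iff inv_iff)
qed

text \<open>The set of elements with a given pair of arcs is nonempty, and any member gives the pair back.\<close>

lemma isom_arcs_pair_elems_eq:
  assumes "P \<in> arc_pairs" "Q \<in> arc_pairs" "pair_elems P = pair_elems Q"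
  shows "P = Q"
proof -
  obtain f where f: "f \<in> fuchs_isom" "P = isom_arcs f"
    using assms(1) by (auto simp: arc_pairs_iff)
  then have "f \<in> pair_elems Q"
    using pair_elems_isom_arcs assms(3) by blast
  with f show ?thesis
    by (simp add: pair_elems_def)
qed

lemma arcs_group_isom_arcs:
  assumes "\<And>i. i < n \<Longrightarrow> f i \<in> fuchs_isom \<and> p i = isom_arcs (f i)"
  shows "arcs_group n p = generate PSL2C (f ` {..<n})"
proof -
  have "(\<Union>i<n. pair_elems (p i)) = (\<Union>i<n. {f i, inv\<^bsub>PSL2C\<^esub> f i})"
    using assms by (intro SUP_cong) (auto simp: pair_elems_isom_arcs)
  moreover have "f ` {..<n} \<subseteq> carrier PSL2C"
    using assms by (auto simp: fuchs_isom_def fuchs_group_carrier)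
  ultimately show ?thesis
    unfolding arcs_group_def
    by (intro group.generate_inv_invariant[OF group_PSL2C]) auto
qed

lemma pair_cyclic_isom_arcs:
  assumes f: "f \<in> fuchs_isom"
  shows "pair_cyclic (isom_arcs f) = cyclic f"
proof -
  have "f \<in> carrier PSL2C"
    using f by (simp add: fuchs_isom_def fuchs_group_carrier)
  then show ?thesis
    unfolding pair_cyclic_def pair_elems_isom_arcs[OF f]
    by (intro group.generate_inv_invariant[OF group_PSL2C]) auto
qed

text \<open>A generator and its inverse have the same isometric circles, and an infinite cyclic group has no
  other generators.\<close>

lemma isom_arcs_cyclic_eq:
  assumes f: "f \<in> fuchs_isom" and g: "g \<in> fuchs_isom"
    and inf: "infinite (cyclic f)" and eq: "cyclic g = cyclic f"
  shows "isom_arcs g = isom_arcs f"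
proof -
  have "f \<in> carrier PSL2C" "g \<in> carrier PSL2C"
    using f g by (simp_all add: fuchs_isom_def fuchs_group_carrier)
  then have "g \<in> pair_elems (isom_arcs f)"
    using group.infinite_cyclic_generators[OF group_PSL2C _ _ inf eq] pair_elems_isom_arcs[OF f] by auto
  then show ?thesis
    by (simp add: pair_elems_def)
qed

lemma corresponds_uniquely_isom_arcs:
  assumes f: "f \<in> fuchs_isom" and inf: "infinite (cyclic f)"
  shows "corresponds_uniquely (cyclic f) (isom_arcs f)"
  unfolding corresponds_uniquely_def
proof (intro conjI ballI inf)
  show "isom_arcs f \<in> arc_pairs"
    using f by (rule isom_arcs_in_arc_pairs)
  fix Q assume "Q \<in> arc_pairs"
  then obtain g where g: "g \<in> fuchs_isom" "Q = isom_arcs g"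
    by (auto simp: arc_pairs_iff)
  then show "pair_cyclic Q = cyclic f \<longleftrightarrow> Q = isom_arcs f"
    using isom_arcs_cyclic_eq[OF f g(1) inf] pair_cyclic_isom_arcs f by metis
qed

lemma choose_generators:
  assumes "p \<in> {..<n} \<rightarrow>\<^sub>E arc_pairs"
  obtains f where "\<And>i. i < n \<Longrightarrow> f i \<in> fuchs_isom \<and> p i = isom_arcs (f i)"
proof -
  have "\<forall>i\<in>{..<n}. \<exists>f\<in>fuchs_isom. p i = isom_arcs f"
    using assms by (simp add: PiE_iff arc_pairs_iff)
  from bchoice[OF this[unfolded Bex_def]] show thesis
    using that by (metis lessThan_iff)
qed

lemma bij_betw_marked_groups:
  "bij_betw (\<lambda>p. (arcs_group n p, \<lambda>i\<in>{..<n}. pair_elems (p i)))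
     ({..<n} \<rightarrow>\<^sub>E arc_pairs) (marked_groups n)"
  unfolding bij_betw_def
proof
  show "inj_on (\<lambda>p. (arcs_group n p, \<lambda>i\<in>{..<n}. pair_elems (p i))) ({..<n} \<rightarrow>\<^sub>E arc_pairs)"
  proof (rule inj_onI)
    fix p q assume p: "p \<in> {..<n} \<rightarrow>\<^sub>E arc_pairs" and q: "q \<in> {..<n} \<rightarrow>\<^sub>E arc_pairs"
      and "(arcs_group n p, \<lambda>i\<in>{..<n}. pair_elems (p i)) = (arcs_group n q, \<lambda>i\<in>{..<n}. pair_elems (q i))"
    then have "pair_elems (p i) = pair_elems (q i)" if "i < n" for i
      using that by (auto dest!: fun_cong[of _ _ i])
    then show "p = q"
      using p q by (intro PiE_ext[OF p q] isom_arcs_pair_elems_eq) auto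
  qed
  show "(\<lambda>p. (arcs_group n p, \<lambda>i\<in>{..<n}. pair_elems (p i))) ` ({..<n} \<rightarrow>\<^sub>E arc_pairs) = marked_groups n"
  proof (intro subset_antisym subsetI)
    fix x assume "x \<in> (\<lambda>p. (arcs_group n p, \<lambda>i\<in>{..<n}. pair_elems (p i))) ` ({..<n} \<rightarrow>\<^sub>E arc_pairs)"
    then obtain p where p: "p \<in> {..<n} \<rightarrow>\<^sub>E arc_pairs"
      and x: "x = (arcs_group n p, \<lambda>i\<in>{..<n}. pair_elems (p i))"
      by blast
    obtain f where f: "\<And>i. i < n \<Longrightarrow> f i \<in> fuchs_isom \<and> p i = isom_arcs (f i)"
      using choose_generators[OF p] by blast
    have "(\<lambda>i\<in>{..<n}. pair_elems (p i)) = (\<lambda>i\<in>{..<n}. {f i, inv\<^bsub>PSL2C\<^esub> (f i)})"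
      using f by (intro restrict_ext) (auto simp: pair_elems_isom_arcs)
    moreover have "arcs_group n p = generate PSL2C (f ` {..<n})"
      using f by (rule arcs_group_isom_arcs)
    ultimately show "x \<in> marked_groups n"
      unfolding x marked_groups_def
      by (intro CollectI exI[of _ f]) (simp add: f)
  next
    fix x assume "x \<in> marked_groups n"
    then obtain f where f: "\<forall>i<n. f i \<in> fuchs_isom"
      and x: "x = (generate PSL2C (f ` {..<n}), \<lambda>i\<in>{..<n}. {f i, inv\<^bsub>PSL2C\<^esub> (f i)})"
      unfolding marked_groups_def by blast
    let ?p = "\<lambda>i\<in>{..<n}. isom_arcs (f i)"
    have "?p \<in> {..<n} \<rightarrow>\<^sub>E arc_pairs"
      using f by (simp add: isom_arcs_in_arc_pairs)
    moreover have "(\<lambda>i\<in>{..<n}. pair_elems (?p i)) = (\<lambda>i\<in>{..<n}. {f i, inv\<^bsub>PSL2C\<^esub> (f i)})"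
      using f by (intro restrict_ext) (auto simp: pair_elems_isom_arcs)
    moreover have "arcs_group n ?p = generate PSL2C (f ` {..<n})"
      using f by (intro arcs_group_isom_arcs) auto
    ultimately show "x \<in> (\<lambda>p. (arcs_group n p, \<lambda>i\<in>{..<n}. pair_elems (p i))) ` ({..<n} \<rightarrow>\<^sub>E arc_pairs)"
      unfolding x by (intro image_eqI[of _ _ ?p]) simp_all
  qed
qed

lemma bij_betw_cyclic_marked_groups:
  "bij_betw (\<lambda>p. (arcs_group n p, \<lambda>i\<in>{..<n}. pair_cyclic (p i)))
     {p \<in> {..<n} \<rightarrow>\<^sub>E arc_pairs. \<forall>i<n. infinite (pair_cyclic (p i))} (cyclic_marked_groups n)"
  (is "bij_betw ?F ?D _")
  unfolding bij_betw_def
proof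
  show "inj_on ?F ?D"
  proof (rule inj_onI)
    fix p q assume p: "p \<in> ?D" and q: "q \<in> ?D" and "?F p = ?F q"
    then have eq: "pair_cyclic (p i) = pair_cyclic (q i)" if "i < n" for i
      using that by (auto dest!: fun_cong[of _ _ i])
    have "p i = q i" if i: "i < n" for i
    proof -
      have "p i \<in> arc_pairs" "q i \<in> arc_pairs"
        using p q i by (auto dest: PiE_mem)
      then obtain f g where fg: "f \<in> fuchs_isom" "p i = isom_arcs f" "g \<in> fuchs_isom" "q i = isom_arcs g"
        unfolding arc_pairs_iff by blast
      then have "cyclic g = cyclic f" "infinite (cyclic f)"
        using eq[OF i] p i by (auto simp: pair_cyclic_isom_arcs)
      with fg show ?thesis
        using isom_arcs_cyclic_eq by metis
    qed
    then show "p = q"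
      using p q by (intro PiE_ext[of p _ _ q]) auto
  qed
  show "?F ` ?D = cyclic_marked_groups n"
  proof (intro subset_antisym subsetI)
    fix x assume "x \<in> ?F ` ?D"
    then obtain p where p: "p \<in> {..<n} \<rightarrow>\<^sub>E arc_pairs" "\<And>i. i < n \<Longrightarrow> infinite (pair_cyclic (p i))"
      and x: "x = ?F p"
      by blast
    obtain f where f: "\<And>i. i < n \<Longrightarrow> f i \<in> fuchs_isom \<and> p i = isom_arcs (f i)"
      using choose_generators[OF p(1)] by blast
    have "(\<lambda>i\<in>{..<n}. pair_cyclic (p i)) = (\<lambda>i\<in>{..<n}. cyclic (f i))"
      using f by (intro restrict_ext) (auto simp: pair_cyclic_isom_arcs)
    moreover have "infinite (cyclic (f i))" if "i < n" for i
      using p(2)[OF that] f[OF that] by (auto simp: pair_cyclic_isom_arcs)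
    moreover have "arcs_group n p = generate PSL2C (f ` {..<n})"
      using f by (rule arcs_group_isom_arcs)
    ultimately show "x \<in> cyclic_marked_groups n"
      unfolding x cyclic_marked_groups_def
      by (intro CollectI exI[of _ f]) (simp add: f)
  next
    fix x assume "x \<in> cyclic_marked_groups n"
    then obtain f where f: "\<forall>i<n. f i \<in> fuchs_isom \<and> infinite (cyclic (f i))"
      and x: "x = (generate PSL2C (f ` {..<n}), \<lambda>i\<in>{..<n}. cyclic (f i))"
      unfolding cyclic_marked_groups_def by blast
    let ?p = "\<lambda>i\<in>{..<n}. isom_arcs (f i)"
    have "?p \<in> ?D"
      using f by (simp add: isom_arcs_in_arc_pairs pair_cyclic_isom_arcs)
    moreover have "(\<lambda>i\<in>{..<n}. pair_cyclic (?p i)) = (\<lambda>i\<in>{..<n}. cyclic (f i))"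
      using f by (intro restrict_ext) (auto simp: pair_cyclic_isom_arcs)
    moreover have "arcs_group n ?p = generate PSL2C (f ` {..<n})"
      using f by (intro arcs_group_isom_arcs) auto
    ultimately show "x \<in> ?F ` ?D"
      unfolding x by (intro image_eqI[of _ _ ?p]) simp_all
  qed
qed

section \<open>The correspondence\<close>

text \<open>The pathwise form of the correspondence: for parameters outside the exceptional null set the
  element has arcs and infinite order, and its cyclic group determines the pair of arcs.\<close>

lemma generic_correspondence:
  assumes f: "f \<in> fuchs_group" and p: "arc_params f = (m1, m2, l)"
    and gen: "(m1, m2, l) \<in> generic_params"
  shows "has_arcs f m1 m2 l \<and>
    corresponds_uniquely (cyclic f) {circle_arc m1 l, circle_arc m2 l}"
proof -
  have dom: "(m1, m2, l) \<in> arc_domain"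
    using gen by (auto simp: generic_params_def)
  obtain a c where ac: "f = fuchs_elem a c" "(a, c) \<in> coeffs"
    using f by (auto simp: fuchs_group_def)
  have "m2 = sgn a * sgn c"
    using p ac by (simp add: arc_params_fuchs_elem phases_to_midpoints_def coeff_polar_def)
  then have "c \<noteq> 0"
    using dom by (auto simp: arc_domain_def)
  then have isom: "f \<in> fuchs_isom"
    using ac by (simp add: fuchs_isom_iff)
  then have "infinite (cyclic f)"
    using gen p by (intro infinite_cyclic_generic) simp_all
  from corresponds_uniquely_isom_arcs[OF isom this]
  have "corresponds_uniquely (cyclic f) {circle_arc m1 l, circle_arc m2 l}"
    by (simp only: isom_arcs_params[OF isom p])
  then show ?thesis
    using isom p has_arcs_iff[OF dom] by simp
qed

lemma AE_generic_law:
  assumes X: "X \<in> measurable M data_algebra" and law: "distr M data_algebra X = uniform_data"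
  shows "AE w in M. X w \<in> generic_params"
  using AE_generic_params AE_distrD[OF X] unfolding law[symmetric] by blast

lemma random_element_arcs:
  fixes f :: "'w \<Rightarrow> (complex^2^2) set"
  assumes f: "random_element M f"
  defines "m1 \<equiv> \<lambda>w. fst (arc_params (f w))" and "m2 \<equiv> \<lambda>w. fst (snd (arc_params (f w)))"
    and "l \<equiv> \<lambda>w. snd (snd (arc_params (f w)))"
  shows "random_arc_pair M m1 m2 l"
    and "AE w in M. has_arcs (f w) (m1 w) (m2 w) (l w) \<and>
      corresponds_uniquely (cyclic (f w)) {circle_arc (m1 w) (l w), circle_arc (m2 w) (l w)}"
proof -
  have M: "prob_space M" and m [measurable]: "f \<in> measurable M fuchs_space"
    using f by (simp_all add: random_element_def)
  have X: "(m1 w, m2 w, l w) = arc_params (f w)" for w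
    by (simp add: m1_def m2_def l_def)
  show "random_arc_pair M m1 m2 l"
    unfolding random_arc_pair_def X using M distr_arc_params[OF f]
    by (simp add: m1_def m2_def l_def)
  have "AE w in M. arc_params (f w) \<in> generic_params"
    using distr_arc_params[OF f] by (intro AE_generic_law) auto
  then show "AE w in M. has_arcs (f w) (m1 w) (m2 w) (l w) \<and>
      corresponds_uniquely (cyclic (f w)) {circle_arc (m1 w) (l w), circle_arc (m2 w) (l w)}"
    using AE_space
  proof eventually_elim
    case (elim w)
    have "f w \<in> fuchs_group"
      using measurable_space[OF m elim(2)] by simp
    then show ?case
      using elim(1) X[of w] by (intro generic_correspondence) simp_all
  qed
qed

lemma random_arcs_element:
  assumes r: "random_arc_pair M m1 m2 l"
  defines "f \<equiv> \<lambda>w. arc_elem (m1 w, m2 w, l w)"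
  shows "random_element M f"
    and "AE w in M. has_arcs (f w) (m1 w) (m2 w) (l w) \<and>
      corresponds_uniquely (cyclic (f w)) {circle_arc (m1 w) (l w), circle_arc (m2 w) (l w)}"
proof -
  have M: "prob_space M" and [measurable]: "m1 \<in> borel_measurable M" "m2 \<in> borel_measurable M"
      "l \<in> borel_measurable M"
    and law: "distr M data_algebra (\<lambda>w. (m1 w, m2 w, l w)) = uniform_data"
    using r by (simp_all add: random_arc_pair_def)
  have X: "(\<lambda>w. (m1 w, m2 w, l w)) \<in> measurable M data_algebra"
    by measurable
  show "random_element M f"
    unfolding f_def by (rule random_element_arc_elem[OF M X law])
  show "AE w in M. has_arcs (f w) (m1 w) (m2 w) (l w) \<and>
      corresponds_uniquely (cyclic (f w)) {circle_arc (m1 w) (l w), circle_arc (m2 w) (l w)}"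
    using AE_generic_law[OF X law]
  proof eventually_elim
    case (elim w)
    then have "(m1 w, m2 w, l w) \<in> arc_domain"
      by (simp add: generic_params_def)
    from arc_elem[OF this] elim show ?case
      unfolding f_def by (intro generic_correspondence) (simp_all add: fuchs_isom_def)
  qed
qed

lemma AE_all_less:
  fixes n :: nat
  assumes "\<And>i. i < n \<Longrightarrow> AE w in M. P i w"
  shows "AE w in M. \<forall>i<n. P i w"
proof -
  have "AE w in M. \<forall>i\<in>{..<n}. P i w"
    by (subst AE_ball_countable) (auto intro: assms)
  then show ?thesis by eventually_elim simp
qed

theorem theorem9p2:
  fixes n :: nat and M :: "'w measure"
  shows
    "(\<forall>m1\<in>sphere 0 1. \<forall>m2\<in>sphere 0 1. \<forall>l\<in>{0<..<pi}.
        (\<exists>!f. has_arcs f m1 m2 l) \<and>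
        (\<forall>f. has_arcs f m1 m2 l \<longrightarrow> has_arcs (inv\<^bsub>PSL2C\<^esub> f) m2 m1 l)) \<and>
     (\<forall>f\<in>fuchs_isom. \<exists>!(m1, m2, l).
        m1 \<in> sphere 0 1 \<and> m2 \<in> sphere 0 1 \<and> l \<in> {0<..<pi} \<and> has_arcs f m1 m2 l) \<and>
     bij_betw (\<lambda>p. (arcs_group n p, \<lambda>i\<in>{..<n}. pair_elems (p i)))
       ({..<n} \<rightarrow>\<^sub>E arc_pairs)
       (marked_groups n) \<and>
     bij_betw (\<lambda>p. (arcs_group n p, \<lambda>i\<in>{..<n}. pair_cyclic (p i)))
       {p \<in> {..<n} \<rightarrow>\<^sub>E arc_pairs. \<forall>i<n. infinite (pair_cyclic (p i))}
       (cyclic_marked_groups n) \<and>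
     (\<forall>f. random_generators M n f \<longrightarrow>
        (\<exists>m1 m2 l. random_arc_collection M n m1 m2 l \<and>
           (AE w in M. \<forall>i<n. has_arcs (f i w) (m1 i w) (m2 i w) (l i w) \<and>
              corresponds_uniquely (cyclic (f i w))
                {circle_arc (m1 i w) (l i w), circle_arc (m2 i w) (l i w)}))) \<and>
     (\<forall>m1 m2 l. random_arc_collection M n m1 m2 l \<longrightarrow>
        (\<exists>f. random_generators M n f \<and>
           (AE w in M. \<forall>i<n. has_arcs (f i w) (m1 i w) (m2 i w) (l i w) \<and>
              corresponds_uniquely (cyclic (f i w))
                {circle_arc (m1 i w) (l i w), circle_arc (m2 i w) (l i w)}))) \<and>
     (\<forall>f. random_element M f \<longrightarrow>
        (\<exists>m1 m2 l. random_arc_pair M m1 m2 l \<and>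
           (AE w in M. has_arcs (f w) (m1 w) (m2 w) (l w) \<and>
              corresponds_uniquely (cyclic (f w))
                {circle_arc (m1 w) (l w), circle_arc (m2 w) (l w)}))) \<and>
     (\<forall>m1 m2 l. random_arc_pair M m1 m2 l \<longrightarrow>
        (\<exists>f. random_element M f \<and>
           (AE w in M. has_arcs (f w) (m1 w) (m2 w) (l w) \<and>
              corresponds_uniquely (cyclic (f w))
                {circle_arc (m1 w) (l w), circle_arc (m2 w) (l w)})))"
proof (intro conjI)
  show "\<forall>m1\<in>sphere 0 1. \<forall>m2\<in>sphere 0 1. \<forall>l\<in>{0<..<pi}.
        (\<exists>!f. has_arcs f m1 m2 l) \<and>
        (\<forall>f. has_arcs f m1 m2 l \<longrightarrow> has_arcs (inv\<^bsub>PSL2C\<^esub> f) m2 m1 l)"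
  proof (intro ballI conjI allI impI)
    fix m1 m2 :: complex and l :: real
    assume "m1 \<in> sphere 0 1" "m2 \<in> sphere 0 1" "l \<in> {0<..<pi}"
    then have dom: "(m1, m2, l) \<in> arc_domain" "(m2, m1, l) \<in> arc_domain"
      by (simp_all add: arc_domain_def)
    show "\<exists>!f. has_arcs f m1 m2 l"
      unfolding has_arcs_iff[OF dom(1)]
      using arc_elem[OF dom(1)] inj_on_arc_params by (metis inj_onD)
    show "has_arcs (inv\<^bsub>PSL2C\<^esub> f) m2 m1 l" if "has_arcs f m1 m2 l" for f
      using that inv_fuchs_isom unfolding has_arcs_iff[OF dom(1)] has_arcs_iff[OF dom(2)] by blast
  qed
next
  show "\<forall>f\<in>fuchs_isom. \<exists>!(m1, m2, l).
        m1 \<in> sphere 0 1 \<and> m2 \<in> sphere 0 1 \<and> l \<in> {0<..<pi} \<and> has_arcs f m1 m2 l"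
  proof
    fix f assume f: "f \<in> fuchs_isom"
    have "m1 \<in> sphere 0 1 \<and> m2 \<in> sphere 0 1 \<and> l \<in> {0<..<pi} \<and> has_arcs f m1 m2 l \<longleftrightarrow>
        (m1, m2, l) = arc_params f" for m1 m2 l
      using f arc_params_in_domain[OF f] has_arcs_iff[of m1 m2 l f]
      by (auto simp: arc_domain_def)
    then show "\<exists>!(m1, m2, l).
        m1 \<in> sphere 0 1 \<and> m2 \<in> sphere 0 1 \<and> l \<in> {0<..<pi} \<and> has_arcs f m1 m2 l"
      by (intro ex1I[of _ "arc_params f"]) (auto split: prod.splits)
  qed
next
  show "\<forall>f. random_generators M n f \<longrightarrow>
        (\<exists>m1 m2 l. random_arc_collection M n m1 m2 l \<and>
           (AE w in M. \<forall>i<n. has_arcs (f i w) (m1 i w) (m2 i w) (l i w) \<and>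
              corresponds_uniquely (cyclic (f i w))
                {circle_arc (m1 i w) (l i w), circle_arc (m2 i w) (l i w)}))"
  proof (intro allI impI)
    fix f assume f: "random_generators M n f"
    then have M: "prob_space M" and el: "\<And>i. i < n \<Longrightarrow> random_element M (f i)"
      and ind: "prob_space.indep_vars M (\<lambda>_. fuchs_space) f {..<n}"
      by (auto simp: random_generators_def)
    define m1 where "m1 = (\<lambda>i w. fst (arc_params (f i w)))"
    define m2 where "m2 = (\<lambda>i w. fst (snd (arc_params (f i w))))"
    define l where "l = (\<lambda>i w. snd (snd (arc_params (f i w))))"
    have "prob_space.indep_vars M (\<lambda>_. data_algebra) (\<lambda>i w. arc_params (f i w)) {..<n}"
      by (rule prob_space.indep_vars_compose2[OF M ind]) measurable
    then have "random_arc_collection M n m1 m2 l"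
      unfolding random_arc_collection_def using M random_element_arcs(1)[OF el]
      by (simp add: m1_def m2_def l_def)
    moreover have "AE w in M. \<forall>i<n. has_arcs (f i w) (m1 i w) (m2 i w) (l i w) \<and>
        corresponds_uniquely (cyclic (f i w)) {circle_arc (m1 i w) (l i w), circle_arc (m2 i w) (l i w)}"
      unfolding m1_def m2_def l_def by (intro AE_all_less random_element_arcs(2) el)
    ultimately show "\<exists>m1 m2 l. random_arc_collection M n m1 m2 l \<and>
           (AE w in M. \<forall>i<n. has_arcs (f i w) (m1 i w) (m2 i w) (l i w) \<and>
              corresponds_uniquely (cyclic (f i w))
                {circle_arc (m1 i w) (l i w), circle_arc (m2 i w) (l i w)})"
      by blast
  qed
next
  show "\<forall>m1 m2 l. random_arc_collection M n m1 m2 l \<longrightarrow>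
        (\<exists>f. random_generators M n f \<and>
           (AE w in M. \<forall>i<n. has_arcs (f i w) (m1 i w) (m2 i w) (l i w) \<and>
              corresponds_uniquely (cyclic (f i w))
                {circle_arc (m1 i w) (l i w), circle_arc (m2 i w) (l i w)}))"
  proof (intro allI impI)
    fix m1 m2 l assume r: "random_arc_collection M n m1 m2 l"
    then have M: "prob_space M" and el: "\<And>i. i < n \<Longrightarrow> random_arc_pair M (m1 i) (m2 i) (l i)"
      and ind: "prob_space.indep_vars M (\<lambda>_. data_algebra) (\<lambda>i w. (m1 i w, m2 i w, l i w)) {..<n}"
      by (auto simp: random_arc_collection_def)
    define f where "f = (\<lambda>i w. arc_elem (m1 i w, m2 i w, l i w))"
    have "prob_space.indep_vars M (\<lambda>_. fuchs_space) f {..<n}"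
      unfolding f_def by (rule prob_space.indep_vars_compose2[OF M ind]) measurable
    then have "random_generators M n f"
      unfolding random_generators_def using M random_arcs_element(1)[OF el]
      by (simp add: f_def)
    moreover have "AE w in M. \<forall>i<n. has_arcs (f i w) (m1 i w) (m2 i w) (l i w) \<and>
        corresponds_uniquely (cyclic (f i w)) {circle_arc (m1 i w) (l i w), circle_arc (m2 i w) (l i w)}"
      unfolding f_def by (intro AE_all_less random_arcs_element(2) el)
    ultimately show "\<exists>f. random_generators M n f \<and>
           (AE w in M. \<forall>i<n. has_arcs (f i w) (m1 i w) (m2 i w) (l i w) \<and>
              corresponds_uniquely (cyclic (f i w))
                {circle_arc (m1 i w) (l i w), circle_arc (m2 i w) (l i w)})"
      by blast
  qed
next
  show "\<forall>f. random_element M f \<longrightarrow>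
        (\<exists>m1 m2 l. random_arc_pair M m1 m2 l \<and>
           (AE w in M. has_arcs (f w) (m1 w) (m2 w) (l w) \<and>
              corresponds_uniquely (cyclic (f w))
                {circle_arc (m1 w) (l w), circle_arc (m2 w) (l w)}))"
  proof (intro allI impI)
    fix f assume f: "random_element M f"
    show "\<exists>m1 m2 l. random_arc_pair M m1 m2 l \<and>
           (AE w in M. has_arcs (f w) (m1 w) (m2 w) (l w) \<and>
              corresponds_uniquely (cyclic (f w))
                {circle_arc (m1 w) (l w), circle_arc (m2 w) (l w)})"
      by (intro exI conjI) (rule random_element_arcs[OF f])+
  qed
next
  show "\<forall>m1 m2 l. random_arc_pair M m1 m2 l \<longrightarrow>
        (\<exists>f. random_element M f \<and>
           (AE w in M. has_arcs (f w) (m1 w) (m2 w) (l w) \<and>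
              corresponds_uniquely (cyclic (f w))
                {circle_arc (m1 w) (l w), circle_arc (m2 w) (l w)}))"
  proof (intro allI impI)
    fix m1 m2 l assume r: "random_arc_pair M m1 m2 l"
    show "\<exists>f. random_element M f \<and>
           (AE w in M. has_arcs (f w) (m1 w) (m2 w) (l w) \<and>
              corresponds_uniquely (cyclic (f w))
                {circle_arc (m1 w) (l w), circle_arc (m2 w) (l w)})"
      by (intro exI conjI) (rule random_arcs_element[OF r])+
  qed
qed (rule bij_betw_marked_groups bij_betw_cyclic_marked_groups)+

end
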